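(* Let $\mathcal{V}$ be a Banach space and $\gamma:[0,1]\to\mathcal{V}$ a continuous path. Suppose there exists a non-decreasing function $m:[0,1]\to[0,\infty)$ satisfying $$\lim_{t\to0}m(t)=0,\quad m(1)\le1,\quad\text{and}\quad\int_0^1\frac{m^2(t)}{t}\,dt<\infty,$$ such that $$\sup_{0\le s<t\le1}\frac{\|\gamma(t)-\gamma(s)\|}{|t-s|^{1/2}m(t-s)}<\infty.$$ Then $\gamma\in\mathcal{G}_2(\mathcal{V})$, i.e. $\gamma$ can be enhanced into a geometric $2$-rough path.
   Context: Let $\triangle_{[0,1]}=\{(s,t):0\le s\le t\le 1\}$, and for a Banach space $\mathcal{W}$ let $C(\triangle_{[0,1]},\mathcal{W})$ be the continuous $\alpha:\triangle_{[0,1]}\to\mathcal{W}$ with $\alpha(t,t)=0$ for all $t$. For $p>0$, $\|\alpha\|_{p-var}=(\sup_{D}\sum_{j}\|\alpha(t_j,t_{j+1})\|^p)^{1/p}$, sup over all finite partitions $D=\{t_j\}$ of $[0,1]$; for a continuous path $\gamma$, $\|\gamma\|_{p-var}$ is the $p$-variation of $(s,t)\mapsto\gamma(t)-\gamma(s)$. $C^{1-var}([0,1],\mathcal{V})$ is the set of continuous paths of finite $1$-variation. $\mathcal{V}\otimes\mathcal{V}$ is the completion of the algebraic tensor product in a norm satisfying $\|v\otimes u\|\le\|v\|\|u\|$; $[v_1,v_2]=v_1\otimes v_2-v_2\otimes v_1$; $[\mathcal{V},\mathcal{V}]$ is the closure in $\mathcal V\otimes\mathcal V$ of the span of all $[v_1,v_2]$.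 For $\gamma\in C^{1-var}([0,1],\mathcal{V})$ the area is $A(\gamma)(s,t)=\frac12\iint_{s<u_1<u_2<t}[d\gamma(u_1),d\gamma(u_2)]$. A pair $(\gamma,\alpha)$ with $\gamma\in C([0,1],\mathcal{V})$, $\alpha\in C(\triangle_{[0,1]},[\mathcal{V},\mathcal{V}])$ is a geometric $2$-rough path if there exist $\gamma_n\in C^{1-var}([0,1],\mathcal{V})$ with $\left(\|\gamma-\gamma_n\|_{2-var}^2+\|\alpha-A(\gamma_n)\|_{1-var}\right)^{1/2}\to0$. $\mathcal{G}_2(\mathcal{V})$ is the set of paths $\gamma$ of vanishing $2$-variation (i.e. $\lim_{\delta\to0}\sup_{|D|\le\delta}\sum_j\|\gamma(t_{j+1})-\gamma(t_j)\|^2=0$, $|D|$ the mesh) for which there exists $\alpha$ such that $(\gamma,\alpha)$ is a geometric $2$-rough path. *)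

theory Defs
  imports "HOL-Analysis.Analysis" "HOL-Library.Poly_Mapping"
begin

section \<open>The algebraic tensor square of a real vector space\<close>

text \<open>
  Finitely supported functions on pairs, i.e. the free real vector space on \<open>V \<times> V\<close>,
  modulo the subspace generated by the bilinearity relations.
\<close>

definition free_scale :: "real \<Rightarrow> ('k \<Rightarrow>\<^sub>0 real) \<Rightarrow> ('k \<Rightarrow>\<^sub>0 real)" where
  "free_scale c p = Poly_Mapping.map (\<lambda>x. c * x) p"

inductive_set tensor_null :: "('v::real_vector \<times> 'v \<Rightarrow>\<^sub>0 real) set" where
  add_left: "Poly_Mapping.single (v + v', u) 1
      - (Poly_Mapping.single (v, u) 1 + Poly_Mapping.single (v', u) 1) \<in> tensor_null"
| add_right: "Poly_Mapping.single (v, u + u') 1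
      - (Poly_Mapping.single (v, u) 1 + Poly_Mapping.single (v, u') 1) \<in> tensor_null"
| scale_left: "Poly_Mapping.single (c *\<^sub>R v, u) 1 - Poly_Mapping.single (v, u) c \<in> tensor_null"
| scale_right: "Poly_Mapping.single (v, c *\<^sub>R u) 1 - Poly_Mapping.single (v, u) c \<in> tensor_null"
| zero: "0 \<in> tensor_null"
| plus: "p \<in> tensor_null \<Longrightarrow> q \<in> tensor_null \<Longrightarrow> p + q \<in> tensor_null"
| scale: "p \<in> tensor_null \<Longrightarrow> free_scale c p \<in> tensor_null"

lemma lookup_free_scale [simp]:
  "Poly_Mapping.lookup (free_scale c p) k = c * Poly_Mapping.lookup p k"
  by (simp add: free_scale_def Poly_Mapping.map.rep_eq when_def)

lemma free_scale_single: "free_scale c (Poly_Mapping.single k a) = Poly_Mapping.single k (c * a)"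
  by (simp add: free_scale_def)

lemma free_scale_algebra:
  "free_scale c (p + q) = free_scale c p + free_scale c q"
  "free_scale c (p - q) = free_scale c p - free_scale c q"
  "free_scale (c + d) p = free_scale c p + free_scale d p"
  "free_scale c (free_scale d p) = free_scale (c * d) p"
  "free_scale 1 p = p"
  "free_scale (- 1) p = - p"
  by (rule poly_mapping_eqI; simp add: lookup_add lookup_minus algebra_simps)+

lemma tensor_null_uminus: "p \<in> tensor_null \<Longrightarrow> - p \<in> tensor_null"
  using tensor_null.scale[of p "-1"] by (simp add: free_scale_algebra)

lemma tensor_null_diff: "p \<in> tensor_null \<Longrightarrow> q \<in> tensor_null \<Longrightarrow> p - q \<in> tensor_null"
  using tensor_null.plus[OF _ tensor_null_uminus] by fastforce

quotient_type (overloaded) 'v tensor2 =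
  "('v::real_vector \<times> 'v) \<Rightarrow>\<^sub>0 real" / "\<lambda>p q. p - q \<in> tensor_null"
proof (rule equivpI)
  show "reflp (\<lambda>p q. p - q \<in> (tensor_null :: ('v \<times> 'v \<Rightarrow>\<^sub>0 real) set))"
    by (simp add: reflp_def tensor_null.zero)
  show "symp (\<lambda>p q. p - q \<in> (tensor_null :: ('v \<times> 'v \<Rightarrow>\<^sub>0 real) set))"
    using tensor_null_uminus by (fastforce simp: symp_def)
  show "transp (\<lambda>p q. p - q \<in> (tensor_null :: ('v \<times> 'v \<Rightarrow>\<^sub>0 real) set))"
    unfolding transp_def
  proof (intro allI impI)
    fix p q r :: "'v \<times> 'v \<Rightarrow>\<^sub>0 real"
    assume "p - q \<in> tensor_null" "q - r \<in> tensor_null"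
    from tensor_null.plus[OF this] show "p - r \<in> tensor_null" by simp
  qed
qed

instantiation tensor2 :: (real_vector) real_vector
begin

lift_definition zero_tensor2 :: "'a tensor2" is 0 .

lift_definition plus_tensor2 :: "'a tensor2 \<Rightarrow> 'a tensor2 \<Rightarrow> 'a tensor2" is "(+)"
  using tensor_null.plus by (fastforce simp: algebra_simps)

lift_definition minus_tensor2 :: "'a tensor2 \<Rightarrow> 'a tensor2 \<Rightarrow> 'a tensor2" is "(-)"
  using tensor_null_diff by (fastforce simp: algebra_simps)

lift_definition uminus_tensor2 :: "'a tensor2 \<Rightarrow> 'a tensor2" is uminus
  using tensor_null_uminus by fastforce

lift_definition scaleR_tensor2 :: "real \<Rightarrow> 'a tensor2 \<Rightarrow> 'a tensor2" is free_scale
  using tensor_null.scale by (fastforce simp flip: free_scale_algebra)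

instance
  by standard (transfer; simp add: algebra_simps free_scale_algebra tensor_null.zero)+

end

lift_definition tensor :: "'v::real_vector \<Rightarrow> 'v \<Rightarrow> 'v tensor2" (infixl "\<otimes>\<^sub>t" 70)
  is "\<lambda>v u. Poly_Mapping.single (v, u) 1" .

lemma bilinear_tensor: "bilinear (\<otimes>\<^sub>t)"
proof -
  have "(v + v') \<otimes>\<^sub>t u = v \<otimes>\<^sub>t u + v' \<otimes>\<^sub>t u" for v v' u :: 'a
    by transfer (rule tensor_null.add_left)
  moreover have "v \<otimes>\<^sub>t (u + u') = v \<otimes>\<^sub>t u + v \<otimes>\<^sub>t u'" for v u u' :: 'a
    by transfer (rule tensor_null.add_right)
  moreover have "(c *\<^sub>R v) \<otimes>\<^sub>t u = c *\<^sub>R (v \<otimes>\<^sub>t u)" for c and v u :: 'a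
    by transfer (simp add: free_scale_single tensor_null.scale_left)
  moreover have "v \<otimes>\<^sub>t (c *\<^sub>R u) = c *\<^sub>R (v \<otimes>\<^sub>t u)" for c and v u :: 'a
    by transfer (simp add: free_scale_single tensor_null.scale_right)
  ultimately show ?thesis
    by (auto simp: bilinear_def intro!: linearI)
qed

section \<open>Completion in a tensor norm, and the bracket\<close>

definition tensor_norm :: "('v::real_normed_vector tensor2 \<Rightarrow> real) \<Rightarrow> bool" where
  "tensor_norm N \<longleftrightarrow>
     (\<forall>x. N x = 0 \<longleftrightarrow> x = 0) \<and>
     (\<forall>x y. N (x + y) \<le> N x + N y) \<and>
     (\<forall>c x. N (c *\<^sub>R x) = \<bar>c\<bar> * N x) \<and>
     (\<forall>v u. N (v \<otimes>\<^sub>t u) \<le> norm v * norm u)"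

text \<open>
  The Banach space \<open>'w\<close>, with canonical map \<open>\<iota>\<close>, is the completion of the algebraic tensor
  square in the norm \<open>N\<close>.
\<close>

definition tensor_completion ::
    "('v::real_normed_vector tensor2 \<Rightarrow> real) \<Rightarrow> ('v tensor2 \<Rightarrow> 'w::banach) \<Rightarrow> bool" where
  "tensor_completion N \<iota> \<longleftrightarrow>
     linear \<iota> \<and> (\<forall>x. norm (\<iota> x) = N x) \<and> closure (range \<iota>) = UNIV"

definition bracket ::
    "('v::real_normed_vector tensor2 \<Rightarrow> 'w::real_normed_vector) \<Rightarrow> 'v \<Rightarrow> 'v \<Rightarrow> 'w" where
  "bracket \<iota> v u = \<iota> (v \<otimes>\<^sub>t u - u \<otimes>\<^sub>t v)"

definition bracket_space ::
    "('v::real_normed_vector tensor2 \<Rightarrow> 'w::real_normed_vector) \<Rightarrow> 'w set" where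
  "bracket_space \<iota> = closure (span {bracket \<iota> v u | v u. True})"

section \<open>Partitions and p-variation\<close>

text \<open>\<open>a = x 0 < x 1 < \<dots> < x n = b\<close>; the values of \<open>x\<close> beyond \<open>n\<close> are irrelevant.\<close>

definition interval_partition :: "real \<Rightarrow> real \<Rightarrow> nat \<Rightarrow> (nat \<Rightarrow> real) \<Rightarrow> bool" where
  "interval_partition a b n x \<longleftrightarrow> x 0 = a \<and> x n = b \<and> (\<forall>i<n. x i < x (Suc i))"

definition mesh_le :: "nat \<Rightarrow> (nat \<Rightarrow> real) \<Rightarrow> real \<Rightarrow> bool" where
  "mesh_le n x \<delta> \<longleftrightarrow> (\<forall>i<n. x (Suc i) - x i \<le> \<delta>)"

definition ennreal_powr :: "ennreal \<Rightarrow> real \<Rightarrow> ennreal" where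
  "ennreal_powr x a = (if x = \<infinity> then \<infinity> else ennreal (enn2real x powr a))"

definition pvar :: "real \<Rightarrow> (real \<Rightarrow> real \<Rightarrow> 'w::real_normed_vector) \<Rightarrow> ennreal" where
  "pvar p \<alpha> = ennreal_powr
     (SUP (n, x) \<in> {(n, x). interval_partition 0 1 n x}.
        ennreal (\<Sum>i<n. norm (\<alpha> (x i) (x (Suc i))) powr p)) (1 / p)"

definition increment :: "(real \<Rightarrow> 'v::real_normed_vector) \<Rightarrow> real \<Rightarrow> real \<Rightarrow> 'v" where
  "increment \<gamma> s t = \<gamma> t - \<gamma> s"

definition C_1var :: "(real \<Rightarrow> 'v::real_normed_vector) set" where
  "C_1var = {\<gamma>. continuous_on {0..1} \<gamma> \<and> pvar 1 (increment \<gamma>) < \<infinity>}"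

definition vanishing_2var :: "(real \<Rightarrow> 'v::real_normed_vector) \<Rightarrow> bool" where
  "vanishing_2var \<gamma> \<longleftrightarrow>
     ((\<lambda>\<delta>. SUP (n, x) \<in> {(n, x). interval_partition 0 1 n x \<and> mesh_le n x \<delta>}.
         ennreal (\<Sum>i<n. (norm (\<gamma> (x (Suc i)) - \<gamma> (x i)))\<^sup>2)) \<longlongrightarrow> 0) (at_right 0)"

section \<open>Riemann--Stieltjes integrals and the area of a path\<close>

text \<open>The integral of \<open>B (f u) (d g(u))\<close> over \<open>[a, b]\<close>, for a bilinear pairing \<open>B\<close>.\<close>

definition has_RS_integral ::
    "('a \<Rightarrow> 'b \<Rightarrow> 'c) \<Rightarrow> (real \<Rightarrow> 'a) \<Rightarrow> (real \<Rightarrow> 'b::real_normed_vector)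
      \<Rightarrow> real \<Rightarrow> real \<Rightarrow> 'c::real_normed_vector \<Rightarrow> bool" where
  "has_RS_integral B f g a b I \<longleftrightarrow>
     (\<forall>\<epsilon>>0. \<exists>\<delta>>0. \<forall>n x \<xi>.
        interval_partition a b n x \<and> mesh_le n x \<delta> \<and> (\<forall>i<n. \<xi> i \<in> {x i..x (Suc i)}) \<longrightarrow>
        norm ((\<Sum>i<n. B (f (\<xi> i)) (g (x (Suc i)) - g (x i))) - I) < \<epsilon>)"

definition RS_integral ::
    "('a \<Rightarrow> 'b \<Rightarrow> 'c) \<Rightarrow> (real \<Rightarrow> 'a) \<Rightarrow> (real \<Rightarrow> 'b::real_normed_vector)
      \<Rightarrow> real \<Rightarrow> real \<Rightarrow> 'c::real_normed_vector" where
  "RS_integral B f g a b = (THE I. has_RS_integral B f g a b I)"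

text \<open>
  The double integral is read as an iterated one: the inner integral is that of \<open>1\<close> against
  \<open>d\<gamma>(u\<^sub>1)\<close> over \<open>[s, u\<^sub>2]\<close>, the outer one pairs it with \<open>d\<gamma>(u\<^sub>2)\<close> through the bracket.
\<close>

definition area ::
    "('v::real_normed_vector tensor2 \<Rightarrow> 'w::real_normed_vector)
      \<Rightarrow> (real \<Rightarrow> 'v) \<Rightarrow> real \<Rightarrow> real \<Rightarrow> 'w" where
  "area \<iota> \<gamma> s t =
     (1 / 2) *\<^sub>R RS_integral (bracket \<iota>)
       (\<lambda>u\<^sub>2. RS_integral (*\<^sub>R) (\<lambda>u\<^sub>1. 1) \<gamma> s u\<^sub>2) \<gamma> s t"

lemma fine_partition_exists:
  fixes a b \<delta> :: real
  assumes "a \<le> b" "\<delta> > 0"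
  shows "\<exists>n x. interval_partition a b n x \<and> mesh_le n x \<delta>"
proof (cases "a = b")
  case True
  then show ?thesis
    by (intro exI[of _ 0] exI[of _ "\<lambda>_. a"]) (simp add: interval_partition_def mesh_le_def)
next
  case False
  with assms have ab: "a < b" by simp
  obtain n :: nat where n: "(b - a) / \<delta> < real n"
    using reals_Archimedean2 by blast
  have "0 < (b - a) / \<delta>" using ab assms by simp
  with n have n0: "real n > 0" by linarith
  define x where "x i = a + (b - a) / real n * real i" for i
  have d: "x (Suc i) - x i = (b - a) / real n" for i
    using n0 by (simp add: x_def distrib_left)
  have "(b - a) / real n > 0" using ab n0 by simp
  then have "x i < x (Suc i)" for i using d[of i] by linarith
  moreover have "x 0 = a" "x n = b" using n0 by (simp_all add: x_def)
  ultimately have "interval_partition a b n x" by (simp add: interval_partition_def)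
  moreover have "mesh_le n x \<delta>"
    unfolding mesh_le_def d using n n0 assms by (simp add: field_simps)
  ultimately show ?thesis by blast
qed

lemma RS_integral_unique:
  fixes g :: "real \<Rightarrow> 'b::real_normed_vector" and I :: "'c::real_normed_vector"
  assumes "a \<le> b" and I: "has_RS_integral B f g a b I"
  shows "RS_integral B f g a b = I"
  unfolding RS_integral_def
proof (rule the_equality)
  show "has_RS_integral B f g a b I" by (fact I)
next
  fix J assume J: "has_RS_integral B f g a b J"
  show "J = I"
  proof (rule ccontr)
    assume "J \<noteq> I"
    then have e: "norm (J - I) / 2 > 0" by simp
    define S where "S n x = (\<Sum>i<n. B (f (x i)) (g (x (Suc i)) - g (x i)))" for n :: nat and x
    have *: "\<exists>\<delta>>0. \<forall>n x. interval_partition a b n x \<and> mesh_le n x \<delta> \<longrightarrow> norm (S n x - K) < norm (J - I) / 2"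
      if "has_RS_integral B f g a b K" for K
    proof -
      from that e obtain \<delta> where d: "\<delta> > 0" "\<And>n x \<xi>. interval_partition a b n x \<Longrightarrow> mesh_le n x \<delta> \<Longrightarrow>
          (\<forall>i<n. \<xi> i \<in> {x i..x (Suc i)}) \<Longrightarrow>
          norm ((\<Sum>i<n. B (f (\<xi> i)) (g (x (Suc i)) - g (x i))) - K) < norm (J - I) / 2"
        unfolding has_RS_integral_def by meson
      have "norm (S n x - K) < norm (J - I) / 2" if "interval_partition a b n x" "mesh_le n x \<delta>" for n x
        unfolding S_def using that by (intro d(2)) (auto simp: interval_partition_def less_imp_le)
      with d(1) show ?thesis by blast
    qed
    from *[OF I] *[OF J] obtain d d' where dd: "d > 0" "d' > 0"
      "\<And>n x. interval_partition a b n x \<Longrightarrow> mesh_le n x d \<Longrightarrow> norm (S n x - I) < norm (J - I) / 2"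
      "\<And>n x. interval_partition a b n x \<Longrightarrow> mesh_le n x d' \<Longrightarrow> norm (S n x - J) < norm (J - I) / 2"
      by metis
    obtain n x where p: "interval_partition a b n x" "mesh_le n x (min d d')"
      using fine_partition_exists[OF \<open>a \<le> b\<close>, of "min d d'"] dd by auto
    then have "mesh_le n x d" "mesh_le n x d'" by (auto simp: mesh_le_def)
    with p dd have "norm (S n x - I) < norm (J - I) / 2" "norm (S n x - J) < norm (J - I) / 2"
      by blast+
    moreover have "norm (J - I) \<le> norm (S n x - I) + norm (S n x - J)"
      using norm_triangle_ineq4[of "S n x - I" "S n x - J"] by simp
    ultimately show False by simp
  qed
qed

lemma RS_integral_one:
  fixes \<gamma> :: "real \<Rightarrow> 'v::real_normed_vector"
  assumes "s \<le> t"
  shows "RS_integral (*\<^sub>R) (\<lambda>_. 1) \<gamma> s t = \<gamma> t - \<gamma> s"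
proof (rule RS_integral_unique[OF assms])
  have "(\<Sum>i<n. \<gamma> (x (Suc i)) - \<gamma> (x i)) = \<gamma> t - \<gamma> s" if "interval_partition s t n x" for n x
    using that sum_lessThan_telescope[of "\<lambda>i. \<gamma> (x i)" n] by (simp add: interval_partition_def)
  then show "has_RS_integral (*\<^sub>R) (\<lambda>_. 1) \<gamma> s t (\<gamma> t - \<gamma> s)"
    by (auto simp: has_RS_integral_def intro!: exI[of _ 1])
qed

section \<open>Geometric 2-rough paths\<close>

definition triangle :: "(real \<times> real) set" where
  "triangle = {(s, t). 0 \<le> s \<and> s \<le> t \<and> t \<le> 1}"

definition C_triangle :: "'w::real_normed_vector set \<Rightarrow> (real \<Rightarrow> real \<Rightarrow> 'w) set" where
  "C_triangle W = {\<alpha>. continuous_on triangle (\<lambda>(s, t). \<alpha> s t)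
      \<and> (\<forall>(s, t) \<in> triangle. \<alpha> s t \<in> W) \<and> (\<forall>t \<in> {0..1}. \<alpha> t t = 0)}"

definition geometric_2_rough_path ::
    "('v::real_normed_vector tensor2 \<Rightarrow> 'w::real_normed_vector)
      \<Rightarrow> (real \<Rightarrow> 'v) \<Rightarrow> (real \<Rightarrow> real \<Rightarrow> 'w) \<Rightarrow> bool" where
  "geometric_2_rough_path \<iota> \<gamma> \<alpha> \<longleftrightarrow>
     continuous_on {0..1} \<gamma> \<and> \<alpha> \<in> C_triangle (bracket_space \<iota>) \<and>
     (\<exists>\<gamma>s :: nat \<Rightarrow> real \<Rightarrow> 'v. (\<forall>n. \<gamma>s n \<in> C_1var) \<and>
        (\<lambda>n. ennreal_powr
           ((pvar 2 (increment (\<lambda>t. \<gamma> t - \<gamma>s n t)))\<^sup>2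
             + pvar 1 (\<lambda>s t. \<alpha> s t - area \<iota> (\<gamma>s n) s t)) (1 / 2)) \<longlonglongrightarrow> 0)"

definition G2 ::
    "('v::real_normed_vector tensor2 \<Rightarrow> 'w::real_normed_vector) \<Rightarrow> (real \<Rightarrow> 'v) set" where
  "G2 \<iota> = {\<gamma>. vanishing_2var \<gamma> \<and> (\<exists>\<alpha>. geometric_2_rough_path \<iota> \<gamma> \<alpha>)}"

end

theory Submission
  imports Defs
begin

text \<open>
  Put \<open>q\<^sub>n = 2\<^sup>-\<^sup>n\<close> and \<open>\<mu>\<^sub>n = c m(q\<^sub>n)\<close>, where \<open>c\<close> is the supremum in the hypothesis; the integral
  condition gives \<open>\<Sum> \<mu>\<^sub>n\<^sup>2 < \<infinity>\<close>. Approximate \<open>\<gamma>\<close> by its averages \<open>\<gamma>\<^sub>n\<close> over windows of length \<open>q\<^sub>n\<close>.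
  These are \<open>C\<^sup>1\<close> with derivative at most \<open>\<mu>\<^sub>n q\<^sub>n\<^sup>-\<^sup>1\<^sup>/\<^sup>2\<close>, and lie within \<open>\<mu>\<^sub>n q\<^sub>n\<^sup>1\<^sup>/\<^sup>2\<close> of \<open>\<gamma>\<close>, uniformly.
  If two \<open>C\<^sup>1\<close> paths have speed at most \<open>K\<close> and uniform distance at most \<open>e\<close>, integration by parts
  bounds the difference of their areas over \<open>[s, t]\<close> by a multiple of \<open>K e (t - s)\<close>. For \<open>\<gamma>\<^sub>n\<close> and
  \<open>\<gamma>\<^sub>n\<^sub>+\<^sub>1\<close> this is a multiple of \<open>\<mu>\<^sub>n\<^sup>2 (t - s)\<close>, so the areas form a Cauchy sequence in 1-variation and
  their limit enhances \<open>\<gamma>\<close>. The increments of \<open>\<gamma> - \<gamma>\<^sub>n\<close> are at most \<open>2 \<mu>\<^sub>n (t - s)\<^sup>1\<^sup>/\<^sup>2\<close>: use the uniform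
  distance if \<open>t - s \<ge> q\<^sub>n\<close> and the bound on the derivative otherwise.
\<close>

section \<open>Riemann--Stieltjes integrals against continuously differentiable paths\<close>

lemma interval_partition_mono:
  assumes "interval_partition a b n x" "i \<le> j" "j \<le> n"
  shows "x i \<le> x j"
  using assms(2,3)
proof (induction rule: dec_induct)
  case (step k)
  then have "x i \<le> x k" by simp
  also have "x k < x (Suc k)" using assms(1) step by (simp add: interval_partition_def)
  finally show ?case by simp
qed simp

lemma interval_partition_in:
  assumes "interval_partition a b n x" "i \<le> n"
  shows "x i \<in> {a..b}"
  using interval_partition_mono[OF assms(1), of 0 i] interval_partition_mono[OF assms(1), of i n] assms
  by (auto simp: interval_partition_def)

text \<open>A bound linear in the length of the interval telescopes over a partition. All variation
  bounds below go through this; the mesh condition serves vanishing 2-variation, where only short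
  intervals satisfy the bound.\<close>

lemma interval_partition_sum_le:
  fixes F :: "real \<Rightarrow> real \<Rightarrow> real"
  assumes p: "interval_partition a b n x" and m: "mesh_le n x \<delta>"
    and F: "\<And>s t. a \<le> s \<Longrightarrow> s < t \<Longrightarrow> t \<le> b \<Longrightarrow> t - s \<le> \<delta> \<Longrightarrow> F s t \<le> c * (t - s)"
  shows "(\<Sum>i<n. F (x i) (x (Suc i))) \<le> c * (b - a)"
proof -
  have "(\<Sum>i<n. F (x i) (x (Suc i))) \<le> (\<Sum>i<n. c * (x (Suc i) - x i))"
  proof (rule sum_mono)
    fix i assume "i \<in> {..<n}"
    then show "F (x i) (x (Suc i)) \<le> c * (x (Suc i) - x i)"
      using interval_partition_in[OF p, of i] interval_partition_in[OF p, of "Suc i"] p m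
      by (intro F) (auto simp: interval_partition_def mesh_le_def)
  qed
  also have "\<dots> = c * (b - a)"
    using p sum_lessThan_telescope[of x n]
    by (simp add: interval_partition_def flip: sum_distrib_left)
  finally show ?thesis .
qed

lemma integral_interval_partition:
  fixes f :: "real \<Rightarrow> 'a::banach"
  assumes p: "interval_partition a b n x" and f: "f integrable_on {a..b}"
  shows "integral {a..b} f = (\<Sum>i<n. integral {x i..x (Suc i)} f)"
proof -
  have "integral {a..x k} f = (\<Sum>i<k. integral {x i..x (Suc i)} f)" if "k \<le> n" for k
    using that
  proof (induction k)
    case 0
    then show ?case using p by (simp add: interval_partition_def)
  next
    case (Suc k)
    have "f integrable_on {a..x (Suc k)}"
      using f interval_partition_in[OF p Suc.prems] by (auto intro: integrable_on_subinterval)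
    moreover have "a \<le> x k" "x k \<le> x (Suc k)"
      using Suc.prems interval_partition_in[OF p, of k] p by (auto simp: interval_partition_def less_imp_le)
    ultimately have "integral {a..x (Suc k)} f = integral {a..x k} f + integral {x k..x (Suc k)} f"
      by (simp add: Henstock_Kurzweil_Integration.integral_combine)
    then show ?case using Suc by simp
  qed
  from this[of n] p show ?thesis by (simp add: interval_partition_def)
qed

text \<open>Cell by cell, a tagged term differs from the integral only by the oscillation of
  \<open>F\<close> against \<open>g'\<close>. Uniform continuity of \<open>F\<close> and boundedness
  of \<open>g'\<close> make the total error small, whatever the tags.\<close>

lemma has_RS_integral_C1:
  fixes F :: "real \<Rightarrow> 'a::real_normed_vector" and g g' :: "real \<Rightarrow> 'b::banach"
    and B :: "'a \<Rightarrow> 'b \<Rightarrow> 'c::banach"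
  assumes B: "bounded_bilinear B" and F: "continuous_on {a..b} F"
    and g: "\<And>u. u \<in> {a..b} \<Longrightarrow> (g has_vector_derivative g' u) (at u)"
    and g': "continuous_on {a..b} g'"
  shows "has_RS_integral B F g a b (integral {a..b} (\<lambda>u. B (F u) (g' u)))"
  unfolding has_RS_integral_def
proof (intro allI impI)
  fix \<epsilon> :: real assume "\<epsilon> > 0"
  interpret bounded_bilinear B by (rule B)
  from pos_bounded obtain M where M: "M > 0" "\<And>x y. norm (B x y) \<le> norm x * norm y * M" by blast
  obtain K where K: "K > 0" "\<And>u. u \<in> {a..b} \<Longrightarrow> norm (g' u) \<le> K"
    using compact_imp_bounded[OF compact_continuous_image[OF g' compact_Icc]]
    unfolding bounded_pos by auto
  \<comment> \<open>The error on a cell is at most \<open>\<eta> * K * M\<close> times its length.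
    The summand 1 gives a strict inequality and keeps the denominator positive when
    \<open>a = b\<close>.\<close>
  define \<eta> where "\<eta> = \<epsilon> / (K * M * (\<bar>b - a\<bar> + 1))"
  have "\<eta> > 0" using \<open>\<epsilon> > 0\<close> K M by (simp add: \<eta>_def)
  have small: "\<eta> * K * M * (b - a) < \<epsilon>"
  proof -
    have "\<eta> * K * M * (b - a) < \<eta> * K * M * (\<bar>b - a\<bar> + 1)"
      using \<open>\<eta> > 0\<close> K M by (intro mult_strict_left_mono) auto
    also have "\<dots> = \<epsilon>" using K M by (simp add: \<eta>_def)
    finally show ?thesis .
  qed
  obtain d where d: "d > 0" "\<And>u v. u \<in> {a..b} \<Longrightarrow> v \<in> {a..b} \<Longrightarrow> dist u v < d \<Longrightarrow> dist (F u) (F v) < \<eta>"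
    using compact_uniformly_continuous[OF F compact_Icc] \<open>\<eta> > 0\<close>
    unfolding uniformly_continuous_on_def by metis
  define h where "h u = B (F u) (g' u)" for u
  have h: "continuous_on {a..b} h"
    unfolding h_def by (rule continuous_on[OF F g'])
  have step: "norm (B (F \<xi>) (g v - g u) - integral {u..v} h) \<le> \<eta> * K * M * (v - u)"
    if "a \<le> u" "u \<le> v" "v \<le> b" "v - u < d" "\<xi> \<in> {u..v}" for u v \<xi>
  proof -
    have sub: "{u..v} \<subseteq> {a..b}" using that by auto
    have "(g' has_integral (g v - g u)) {u..v}"
      using that sub by (intro fundamental_theorem_of_calculus has_vector_derivative_at_within[OF g]) auto
    \<comment> \<open>The bounded linear map \<open>B (F \<xi>)\<close>, applied to the fundamental
      theorem of calculus, turns the term of the sum into an integral over the cell.\<close>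
    from has_integral_linear[OF this bounded_linear_right[of "F \<xi>"]]
    have i1: "integral {u..v} (\<lambda>w. B (F \<xi>) (g' w)) = B (F \<xi>) (g v - g u)"
      by (simp add: o_def integral_unique)
    have c1: "continuous_on {u..v} (\<lambda>w. B (F \<xi>) (g' w))"
      by (intro continuous_on continuous_on_subset[OF g' sub] continuous_intros)
    have "B (F \<xi>) (g v - g u) - integral {u..v} h = integral {u..v} (\<lambda>w. B (F \<xi>) (g' w) - h w)"
      unfolding i1[symmetric]
      by (rule integral_diff[symmetric])
         (use c1 continuous_on_subset[OF h sub] in \<open>auto intro: integrable_continuous_real\<close>)
    also have "norm \<dots> \<le> \<eta> * K * M * (v - u)"
    proof (rule integral_bound)
      show "continuous_on {u..v} (\<lambda>w. B (F \<xi>) (g' w) - h w)"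
        by (intro continuous_on_diff c1 continuous_on_subset[OF h sub])
      fix w assume w: "w \<in> {u..v}"
      have "norm (B (F \<xi>) (g' w) - h w) = norm (B (F \<xi> - F w) (g' w))"
        by (simp add: h_def diff_left)
      also have "\<dots> \<le> norm (F \<xi> - F w) * norm (g' w) * M" by (rule M)
      also have "\<dots> \<le> \<eta> * K * M"
        using d(2)[of \<xi> w] w that K(2)[of w] sub M(1) \<open>\<eta> > 0\<close>
        by (intro mult_right_mono mult_mono) (auto simp: dist_norm intro: less_imp_le)
      finally show "norm (B (F \<xi>) (g' w) - h w) \<le> \<eta> * K * M" .
    qed (use that in auto)
    finally show ?thesis .
  qed
  show "\<exists>\<delta>>0. \<forall>n x \<xi>. interval_partition a b n x \<and> mesh_le n x \<delta> \<and> (\<forall>i<n. \<xi> i \<in> {x i..x (Suc i)}) \<longrightarrow>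
      norm ((\<Sum>i<n. B (F (\<xi> i)) (g (x (Suc i)) - g (x i))) - integral {a..b} (\<lambda>u. B (F u) (g' u))) < \<epsilon>"
  \<comment> \<open>\<open>mesh_le\<close> is a weak inequality, while uniform continuity asks for
    distances strictly below \<open>d\<close>.\<close>
  proof (intro exI[of _ "d / 2"] conjI allI impI)
    fix n x \<xi>
    assume "interval_partition a b n x \<and> mesh_le n x (d / 2) \<and> (\<forall>i<n. \<xi> i \<in> {x i..x (Suc i)})"
    then have p: "interval_partition a b n x" and m: "mesh_le n x (d / 2)"
      and \<xi>: "\<And>i. i < n \<Longrightarrow> \<xi> i \<in> {x i..x (Suc i)}" by auto
    have le: "a \<le> x i" "x i < x (Suc i)" "x (Suc i) \<le> b" "x (Suc i) - x i < d" if "i < n" for i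
      using that d(1) p m interval_partition_in[OF p, of i] interval_partition_in[OF p, of "Suc i"]
      by (auto simp: interval_partition_def mesh_le_def intro: le_less_trans[of _ "d / 2"])
    have "(\<Sum>i<n. B (F (\<xi> i)) (g (x (Suc i)) - g (x i))) - integral {a..b} h
        = (\<Sum>i<n. B (F (\<xi> i)) (g (x (Suc i)) - g (x i)) - integral {x i..x (Suc i)} h)"
      by (simp add: integral_interval_partition[OF p integrable_continuous_real[OF h]] sum_subtractf)
    also have "norm \<dots> \<le> (\<Sum>i<n. \<eta> * K * M * (x (Suc i) - x i))"
      using le \<xi> by (intro sum_norm_le step) (auto intro: less_imp_le)
    also have "\<dots> = \<eta> * K * M * (b - a)"
      using p sum_lessThan_telescope[of x n]
      by (simp add: interval_partition_def flip: sum_distrib_left)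
    also note small
    finally show "norm ((\<Sum>i<n. B (F (\<xi> i)) (g (x (Suc i)) - g (x i)))
        - integral {a..b} (\<lambda>u. B (F u) (g' u))) < \<epsilon>" by (simp add: h_def[abs_def])
  qed (use d in simp)
qed

text \<open>Tags never leave \<open>{a..b}\<close>. This matters for the area, whose inner integral
  is known to be an increment only for upper limits at or above \<open>s\<close>.\<close>

lemma has_RS_integral_cong:
  assumes "has_RS_integral B F g a b I" "\<And>u. u \<in> {a..b} \<Longrightarrow> F u = G u"
  shows "has_RS_integral B G g a b I"
  unfolding has_RS_integral_def
proof (intro allI impI)
  fix e :: real assume "e > 0"
  with assms(1) obtain d where d: "d > 0" "\<And>n x \<xi>. interval_partition a b n x \<Longrightarrow> mesh_le n x d \<Longrightarrow>
      (\<forall>i<n. \<xi> i \<in> {x i..x (Suc i)}) \<Longrightarrow>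
      norm ((\<Sum>i<n. B (F (\<xi> i)) (g (x (Suc i)) - g (x i))) - I) < e"
    unfolding has_RS_integral_def by meson
  have "norm ((\<Sum>i<n. B (G (\<xi> i)) (g (x (Suc i)) - g (x i))) - I) < e"
    if p: "interval_partition a b n x" "mesh_le n x d" and \<xi>: "\<forall>i<n. \<xi> i \<in> {x i..x (Suc i)}" for n x \<xi>
  proof -
    have "\<xi> i \<in> {a..b}" if "i < n" for i
      using that \<xi> interval_partition_in[OF p(1), of i] interval_partition_in[OF p(1), of "Suc i"] by fastforce
    then have "(\<Sum>i<n. B (G (\<xi> i)) (g (x (Suc i)) - g (x i))) = (\<Sum>i<n. B (F (\<xi> i)) (g (x (Suc i)) - g (x i)))"
      by (intro sum.cong) (simp_all add: assms(2))
    with d(2)[OF p \<xi>] show ?thesis by simp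
  qed
  with d(1) show "\<exists>\<delta>>0. \<forall>n x \<xi>. interval_partition a b n x \<and> mesh_le n x \<delta> \<and> (\<forall>i<n. \<xi> i \<in> {x i..x (Suc i)}) \<longrightarrow>
      norm ((\<Sum>i<n. B (G (\<xi> i)) (g (x (Suc i)) - g (x i))) - I) < e"
    by blast
qed

text \<open>Riemann sums lie in the span and approximate the integral. This is what places areas in
  \<open>bracket_space\<close>.\<close>

lemma has_RS_integral_in_closure_span:
  assumes "a \<le> b" and "has_RS_integral B F g a b I" and S: "\<And>x y. B x y \<in> S"
  shows "I \<in> closure (span S)"
  unfolding closure_approachable
proof (intro allI impI)
  fix e :: real assume "e > 0"
  with assms(2) obtain d where d: "d > 0" "\<And>n x \<xi>. interval_partition a b n x \<Longrightarrow> mesh_le n x d \<Longrightarrow>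
      (\<forall>i<n. \<xi> i \<in> {x i..x (Suc i)}) \<Longrightarrow>
      norm ((\<Sum>i<n. B (F (\<xi> i)) (g (x (Suc i)) - g (x i))) - I) < e"
    unfolding has_RS_integral_def by meson
  obtain n x where "interval_partition a b n x" "mesh_le n x d"
    using fine_partition_exists[OF assms(1) d(1)] by blast
  then have "norm ((\<Sum>i<n. B (F (x i)) (g (x (Suc i)) - g (x i))) - I) < e"
    by (intro d(2)) (auto simp: interval_partition_def less_imp_le)
  moreover have "(\<Sum>i<n. B (F (x i)) (g (x (Suc i)) - g (x i))) \<in> span S"
    by (intro span_sum span_base S)
  ultimately show "\<exists>y\<in>span S. dist y I < e" by (auto simp: dist_norm)
qed

section \<open>Areas of continuously differentiable paths\<close>

text \<open>\<open>K\<close> is any bound on the speed, not the best one, so that two paths can be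
  compared with a common \<open>K\<close>. The derivative is two-sided even at 0 and 1, as it is for
  averages of a path defined on the whole line.\<close>

locale C1_path =
  fixes f f' :: "real \<Rightarrow> 'v::banach" and K :: real
  assumes deriv: "\<And>u. u \<in> {0..1} \<Longrightarrow> (f has_vector_derivative f' u) (at u)"
    and cont_deriv: "continuous_on {0..1} f'"
    and deriv_le: "\<And>u. u \<in> {0..1} \<Longrightarrow> norm (f' u) \<le> K"
begin

lemma bound_nonneg: "0 \<le> K"
  using order_trans[OF norm_ge_zero deriv_le[of 0]] by simp

lemma continuous: "continuous_on {0..1} f"
  using deriv by (meson continuous_at_imp_continuous_on has_vector_derivative_continuous)

lemma lipschitz:
  assumes "0 \<le> s" "s \<le> t" "t \<le> 1"
  shows "norm (f t - f s) \<le> K * (t - s)"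
proof -
  have "(f' has_integral (f t - f s)) {s..t}"
    using assms by (intro fundamental_theorem_of_calculus has_vector_derivative_at_within[OF deriv]) auto
  then have "f t - f s = integral {s..t} f'" by (simp add: integral_unique)
  also have "norm \<dots> \<le> K * (t - s)"
    using assms by (intro integral_bound deriv_le continuous_on_subset[OF cont_deriv]) auto
  finally show ?thesis .
qed

lemma continuous_on_interval:
  assumes "0 \<le> s" "t \<le> 1"
  shows "continuous_on {s..t} f" "continuous_on {s..t} f'"
  using assms continuous cont_deriv by (auto elim: continuous_on_subset)

end

text \<open>The inner integral is the increment \<open>f u - f s\<close>, so the outer one is an
  integral of a continuous function against a continuously differentiable path.\<close>

lemma has_RS_integral_increment_C1:
  fixes B :: "'v::banach \<Rightarrow> 'v \<Rightarrow> 'w::banach"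
  assumes "bounded_bilinear B" "C1_path f f' K" "0 \<le> s" "t \<le> 1"
  shows "has_RS_integral B (\<lambda>u. RS_integral (*\<^sub>R) (\<lambda>_. 1) f s u) f s t
    (integral {s..t} (\<lambda>u. B (f u - f s) (f' u)))"
proof -
  interpret C1_path f f' K by fact
  have "has_RS_integral B (\<lambda>u. f u - f s) f s t (integral {s..t} (\<lambda>u. B (f u - f s) (f' u)))"
    using assms(3,4) continuous_on_interval[OF assms(3,4)]
    by (intro has_RS_integral_C1 assms(1) deriv continuous_on_diff continuous_on_const) auto
  then show ?thesis
    by (rule has_RS_integral_cong) (simp add: RS_integral_one)
qed

lemma area_C1:
  fixes \<iota> :: "'v::banach tensor2 \<Rightarrow> 'w::banach"
  assumes "bounded_bilinear (bracket \<iota>)" "C1_path f f' K" "0 \<le> s" "s \<le> t" "t \<le> 1"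
  shows "area \<iota> f s t = (1 / 2) *\<^sub>R integral {s..t} (\<lambda>u. bracket \<iota> (f u - f s) (f' u))"
  unfolding area_def
  by (subst RS_integral_unique[OF assms(4) has_RS_integral_increment_C1]) (use assms in auto)

lemma area_C1_in_bracket_space:
  fixes \<iota> :: "'v::banach tensor2 \<Rightarrow> 'w::banach"
  assumes "bounded_bilinear (bracket \<iota>)" "C1_path f f' K" "0 \<le> s" "s \<le> t" "t \<le> 1"
  shows "area \<iota> f s t \<in> bracket_space \<iota>"
proof -
  let ?S = "{bracket \<iota> v u | v u. True}"
  have "integral {s..t} (\<lambda>u. bracket \<iota> (f u - f s) (f' u)) \<in> closure (span ?S)"
    by (rule has_RS_integral_in_closure_span[OF assms(4) has_RS_integral_increment_C1]) (use assms in auto)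
  then have "(1 / 2) *\<^sub>R integral {s..t} (\<lambda>u. bracket \<iota> (f u - f s) (f' u)) \<in> closure ((*\<^sub>R) (1 / 2) ` span ?S)"
    using closure_scaleR[of "1 / 2" "span ?S"] by blast
  also have "\<dots> \<subseteq> closure (span ?S)"
    by (intro closure_mono) (auto intro: span_scale)
  finally show ?thesis
    by (simp add: area_C1[OF assms] bracket_space_def)
qed

text \<open>By bilinearity, the starting point \<open>s\<close> leaves the integrand: twice the area
  is \<open>P t - P s - bracket \<iota> (f s) (f t - f s)\<close>. Joint continuity then reduces to
  that of functions of one variable.\<close>

lemma continuous_on_area_C1:
  fixes \<iota> :: "'v::banach tensor2 \<Rightarrow> 'w::banach"
  assumes B: "bounded_bilinear (bracket \<iota>)" and f: "C1_path f f' K"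
  shows "continuous_on triangle (\<lambda>(s, t). area \<iota> f s t)"
proof -
  interpret C1_path f f' K by fact
  interpret B: bounded_bilinear "bracket \<iota>" by fact
  define h where "h u = bracket \<iota> (f u) (f' u)" for u
  define P where "P t = integral {0..t} h" for t
  have h: "continuous_on {0..1} h"
    unfolding h_def by (intro B.continuous_on continuous cont_deriv)
  have P: "continuous_on {0..1} P"
    unfolding P_def by (intro indefinite_integral_continuous_1 integrable_continuous_real h)
  have eq: "area \<iota> f s t = (1 / 2) *\<^sub>R (P t - P s - bracket \<iota> (f s) (f t - f s))"
    if st: "0 \<le> s" "s \<le> t" "t \<le> 1" for s t
  proof -
    have i1: "(h has_integral (P t - P s)) {s..t}"
    proof -
      have "h integrable_on {0..t}" "h integrable_on {s..t}"
        using st by (auto intro!: integrable_continuous_real continuous_on_subset[OF h])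
      then show ?thesis
        using st Henstock_Kurzweil_Integration.integral_combine[of 0 s t h]
        by (simp add: P_def has_integral_iff algebra_simps)
    qed
    have "(f' has_integral (f t - f s)) {s..t}"
      using st by (intro fundamental_theorem_of_calculus has_vector_derivative_at_within[OF deriv]) auto
    from has_integral_linear[OF this B.bounded_linear_right[of "f s"]]
    have "((\<lambda>u. bracket \<iota> (f s) (f' u)) has_integral bracket \<iota> (f s) (f t - f s)) {s..t}"
      by (simp add: o_def)
    from has_integral_diff[OF i1 this] show ?thesis
      unfolding area_C1[OF B f st] by (simp add: h_def B.diff_left integral_unique)
  qed
  have c: "continuous_on triangle (\<lambda>x. g (fst x))" "continuous_on triangle (\<lambda>x. g (snd x))"
    if "continuous_on {0..1} g" for g :: "real \<Rightarrow> 'z::topological_space"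
    by (rule continuous_on_compose2[OF that]; auto simp: triangle_def intro!: continuous_intros)+
  have "continuous_on triangle (\<lambda>x. (1 / 2) *\<^sub>R (P (snd x) - P (fst x)
      - bracket \<iota> (f (fst x)) (f (snd x) - f (fst x))))"
    by (intro continuous_intros B.continuous_on c P continuous)
  then show ?thesis
    by (rule continuous_on_eq) (auto simp: triangle_def eq)
qed

text \<open>Integrating by parts moves the derivative off \<open>f - g\<close>, which is only small in the uniform norm.\<close>

lemma area_C1_diff_le:
  fixes \<iota> :: "'v::banach tensor2 \<Rightarrow> 'w::banach"
  assumes B: "bounded_bilinear (bracket \<iota>)"
    and M: "0 \<le> M" "\<And>x y. norm (bracket \<iota> x y) \<le> M * norm x * norm y"
    and f: "C1_path f f' K" and g: "C1_path g g' K"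
    and e: "\<And>u. u \<in> {0..1} \<Longrightarrow> norm (f u - g u) \<le> e"
    and st: "0 \<le> s" "s \<le> t" "t \<le> 1"
  shows "norm (area \<iota> f s t - area \<iota> g s t) \<le> 3 * M * K * e * (t - s)"
proof -
  interpret f: C1_path f f' K by fact
  interpret g: C1_path g g' K by fact
  interpret B: bounded_bilinear "bracket \<iota>" by fact
  \<comment> \<open>\<open>d\<close> is the increment of \<open>f - g\<close> from \<open>s\<close>,
    hence at most \<open>2 * e\<close>; the derivative of \<open>d\<close> admits no such small
    bound.\<close>
  define d where "d u = (f u - f s) - (g u - g s)" for u
  define G where "G u = g u - g s" for u
  have "0 \<le> e" using order_trans[OF norm_ge_zero e[of 0]] by simp
  have d_le: "norm (d u) \<le> 2 * e" if "u \<in> {s..t}" for u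
  proof -
    have "d u = (f u - g u) - (f s - g s)" by (simp add: d_def)
    then show ?thesis
      using norm_triangle_ineq4[of "f u - g u" "f s - g s"] e[of u] e[of s] that st by simp
  qed
  have cf: "continuous_on {s..t} f" "continuous_on {s..t} f'" "continuous_on {s..t} g" "continuous_on {s..t} g'"
    using st f.continuous_on_interval g.continuous_on_interval by auto
  have cd: "continuous_on {s..t} d" "continuous_on {s..t} G"
    unfolding d_def G_def by (intro continuous_intros cf)+
  \<comment> \<open>Product rule for the bracket of \<open>G\<close> and \<open>d\<close>. The
    boundary term at \<open>s\<close> vanishes because \<open>G s = 0\<close>.\<close>
  have "((\<lambda>u. bracket \<iota> (G u) (f' u - g' u) + bracket \<iota> (g' u) (d u)) has_integral
      (bracket \<iota> (G t) (d t) - bracket \<iota> (G s) (d s))) {s..t}"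
  proof (rule fundamental_theorem_of_calculus[OF st(2)])
    fix u assume "u \<in> {s..t}"
    then have u: "u \<in> {0..1}" using st by auto
    have f': "((\<lambda>u. f u - f s) has_vector_derivative f' u - 0) (at u within {s..t})"
      by (intro has_vector_derivative_diff has_vector_derivative_const
          has_vector_derivative_at_within[OF f.deriv[OF u]])
    have g': "((\<lambda>u. g u - g s) has_vector_derivative g' u - 0) (at u within {s..t})"
      by (intro has_vector_derivative_diff has_vector_derivative_const
          has_vector_derivative_at_within[OF g.deriv[OF u]])
    have "(G has_vector_derivative g' u) (at u within {s..t})"
      using g' unfolding G_def by simp
    moreover have "(d has_vector_derivative f' u - g' u) (at u within {s..t})"
      using has_vector_derivative_diff[OF f' g'] unfolding d_def by simp
    ultimately show "((\<lambda>u. bracket \<iota> (G u) (d u)) has_vector_derivative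
        bracket \<iota> (G u) (f' u - g' u) + bracket \<iota> (g' u) (d u)) (at u within {s..t})"
      by (rule B.has_vector_derivative)
  qed
  then have parts: "integral {s..t} (\<lambda>u. bracket \<iota> (G u) (f' u - g' u) + bracket \<iota> (g' u) (d u))
      = bracket \<iota> (G t) (d t)"
    by (simp add: G_def B.zero_left integral_unique)
  \<comment> \<open>The difference of the two integrands is the bracket of \<open>d\<close> and
    \<open>f'\<close> plus that of \<open>G\<close> and \<open>f' - g'\<close>. Once the
    product-rule integrand is split off, \<open>R\<close> remains, and it contains \<open>d\<close>
    but no derivative of \<open>d\<close>.\<close>
  define R where "R u = bracket \<iota> (d u) (f' u) - bracket \<iota> (g' u) (d u)" for u
  have cR: "continuous_on {s..t} R"
    unfolding R_def by (intro continuous_intros B.continuous_on cd cf)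
  have "integral {s..t} (\<lambda>u. bracket \<iota> (f u - f s) (f' u)) - integral {s..t} (\<lambda>u. bracket \<iota> (g u - g s) (g' u))
      = integral {s..t} (\<lambda>u. bracket \<iota> (f u - f s) (f' u) - bracket \<iota> (g u - g s) (g' u))"
    by (intro integral_diff[symmetric] integrable_continuous_real continuous_intros B.continuous_on cf)
  also have "\<dots> = integral {s..t} (\<lambda>u. R u + (bracket \<iota> (G u) (f' u - g' u) + bracket \<iota> (g' u) (d u)))"
    by (rule integral_cong) (simp add: R_def G_def d_def B.diff_left B.diff_right)
  also have "\<dots> = integral {s..t} R + bracket \<iota> (G t) (d t)"
    unfolding parts[symmetric]
    by (intro integral_add integrable_continuous_real cR continuous_intros B.continuous_on cf cd)
  finally have "area \<iota> f s t - area \<iota> g s t = (1 / 2) *\<^sub>R (integral {s..t} R + bracket \<iota> (G t) (d t))"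
    by (simp add: area_C1[OF B f st] area_C1[OF B g st] flip: scaleR_diff_right)
  \<comment> \<open>The two terms of \<open>R\<close> give 4 and the boundary term gives 2; the
    factor 1/2 of the area turns the total 6 into 3.\<close>
  moreover have "norm (integral {s..t} R) \<le> (4 * M * K * e) * (t - s)"
  proof (rule integral_bound[OF st(2) cR])
    fix u assume u: "u \<in> {s..t}"
    then have "u \<in> {0..1}" using st by auto
    then have "norm (bracket \<iota> (d u) (f' u)) \<le> M * (2 * e) * K" "norm (bracket \<iota> (g' u) (d u)) \<le> M * K * (2 * e)"
      using d_le[OF u] f.deriv_le[of u] g.deriv_le[of u] M(1) \<open>0 \<le> e\<close> f.bound_nonneg
      by (auto intro!: order_trans[OF M(2)] mult_mono)
    then show "norm (R u) \<le> 4 * M * K * e"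
      unfolding R_def by (intro order_trans[OF norm_triangle_ineq4]) (simp add: algebra_simps)
  qed
  moreover have "norm (bracket \<iota> (G t) (d t)) \<le> M * (K * (t - s)) * (2 * e)"
    using g.lipschitz[OF st] d_le[of t] M(1) \<open>0 \<le> e\<close> f.bound_nonneg st
    by (intro order_trans[OF M(2)] mult_mono) (auto simp: G_def)
  ultimately have "norm (area \<iota> f s t - area \<iota> g s t)
      \<le> \<bar>1 / 2\<bar> * (4 * M * K * e * (t - s) + M * (K * (t - s)) * (2 * e))"
    by (simp only: norm_scaleR mult_left_mono order_trans[OF norm_triangle_ineq add_mono] abs_ge_zero)
  also have "\<dots> = 3 * M * K * e * (t - s)" by (simp add: algebra_simps)
  finally show ?thesis .
qed

section \<open>Bounds on the variation\<close>

lemma ennreal_powr_mono: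
  assumes "x \<le> y" "0 \<le> a"
  shows "ennreal_powr x a \<le> ennreal_powr y a"
proof (cases "y = \<infinity>")
  case False
  then have "enn2real x \<le> enn2real y" "x \<noteq> \<infinity>"
    using assms(1) by (auto intro!: enn2real_mono simp: top.not_eq_extremum top_unique)
  with False assms(2) show ?thesis
    by (auto simp: ennreal_powr_def intro!: ennreal_leI powr_mono2)
qed (simp add: ennreal_powr_def)

lemma ennreal_powr_ennreal: "0 \<le> x \<Longrightarrow> ennreal_powr (ennreal x) a = ennreal (x powr a)"
  by (simp add: ennreal_powr_def)

lemma pvar_le:
  assumes "0 < p" "0 \<le> c"
    and \<alpha>: "\<And>s t. 0 \<le> s \<Longrightarrow> s < t \<Longrightarrow> t \<le> 1 \<Longrightarrow> norm (\<alpha> s t) powr p \<le> c * (t - s)"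
  shows "pvar p \<alpha> \<le> ennreal (c powr (1 / p))"
proof -
  have "(SUP (n, x) \<in> {(n, x). interval_partition 0 1 n x}.
      ennreal (\<Sum>i<n. norm (\<alpha> (x i) (x (Suc i))) powr p)) \<le> ennreal c"
  proof (rule SUP_least, clarify)
    fix n x assume p: "interval_partition 0 1 n x"
    \<comment> \<open>Every partition of the unit interval has mesh at most 1, so the mesh condition
      restricts nothing here.\<close>
    have "mesh_le n x 1"
      unfolding mesh_le_def
    proof (intro allI impI)
      fix i assume "i < n"
      then show "x (Suc i) - x i \<le> 1"
        using interval_partition_in[OF p, of i] interval_partition_in[OF p, of "Suc i"] by simp
    qed
    from interval_partition_sum_le[OF p this, of "\<lambda>s t. norm (\<alpha> s t) powr p" c]
    show "ennreal (\<Sum>i<n. norm (\<alpha> (x i) (x (Suc i))) powr p) \<le> ennreal c"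
      using \<alpha> by (intro ennreal_leI) simp
  qed
  then have "pvar p \<alpha> \<le> ennreal_powr (ennreal c) (1 / p)"
    unfolding pvar_def using assms(1) by (intro ennreal_powr_mono) auto
  then show ?thesis using assms(2) by (simp add: ennreal_powr_ennreal)
qed

lemma (in C1_path) in_C_1var: "f \<in> C_1var"
proof -
  have "pvar 1 (increment f) \<le> ennreal (K powr (1 / 1))"
    using lipschitz bound_nonneg by (intro pvar_le) (auto simp: increment_def)
  also have "\<dots> < \<infinity>" by simp
  finally show ?thesis using continuous by (simp add: C_1var_def)
qed

section \<open>Steklov averages\<close>

text \<open>The window lies to the right of \<open>t\<close>, so near 1 the average uses values of
  \<open>g\<close> beyond 1.\<close>

definition steklov_average :: "real \<Rightarrow> (real \<Rightarrow> 'v::banach) \<Rightarrow> real \<Rightarrow> 'v" where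
  "steklov_average h g t = (1 / h) *\<^sub>R integral {t..t + h} g"

text \<open>The average is a difference quotient, with step \<open>h\<close>, of an antiderivative
  of \<open>g\<close>.\<close>

lemma has_vector_derivative_steklov_average:
  fixes g :: "real \<Rightarrow> 'v::banach"
  assumes g: "continuous_on UNIV g" and h: "0 < h"
  shows "(steklov_average h g has_vector_derivative (1 / h) *\<^sub>R (g (t + h) - g t)) (at t)"
proof -
  \<comment> \<open>The base point \<open>t - 1\<close> lies to the left of \<open>t\<close>, so
    that \<open>t\<close> and \<open>t + h\<close> are interior and the derivatives of
    \<open>P\<close> there are two-sided.\<close>
  define P where "P x = integral {t - 1..x} g" for x
  have P: "(P has_vector_derivative g x) (at x)" if "t - 1 < x" for x
  proof -
    have "(P has_vector_derivative g x) (at x within {t - 1..x + 1})"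
      unfolding P_def using that
      by (intro integral_has_vector_derivative continuous_on_subset[OF g]) auto
    then show ?thesis
      using that by (simp add: at_within_Icc_at)
  qed
  have "((P \<circ> (\<lambda>x. x + h)) has_vector_derivative 1 *\<^sub>R g (t + h)) (at t)"
    using h by (intro vector_diff_chain_at P) (auto intro!: derivative_eq_intros)
  then have "((\<lambda>x. (1 / h) *\<^sub>R (P (x + h) - P x)) has_vector_derivative (1 / h) *\<^sub>R (g (t + h) - g t)) (at t)"
    using P[of t] by (auto intro!: derivative_eq_intros simp: o_def)
  then show ?thesis
  proof (rule has_vector_derivative_transform_within_open[of _ _ _ "{t - 1<..}"])
    fix y assume "y \<in> {t - 1<..}"
    moreover have "g integrable_on {t - 1..y + h}"
      by (intro integrable_continuous_real continuous_on_subset[OF g]) simp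
    ultimately have "P y + integral {y..y + h} g = P (y + h)"
      unfolding P_def using h by (intro Henstock_Kurzweil_Integration.integral_combine) auto
    then show "(1 / h) *\<^sub>R (P (y + h) - P y) = steklov_average h g y"
      by (simp add: steklov_average_def algebra_simps flip: scaleR_diff_right)
  qed auto
qed

lemma C1_path_steklov_average:
  fixes g :: "real \<Rightarrow> 'v::banach"
  assumes g: "continuous_on UNIV g" and h: "0 < h"
    and r: "\<And>t. norm (g (t + h) - g t) \<le> r"
  shows "C1_path (steklov_average h g) (\<lambda>t. (1 / h) *\<^sub>R (g (t + h) - g t)) (r / h)"
proof
  show "continuous_on {0..1} (\<lambda>t. (1 / h) *\<^sub>R (g (t + h) - g t))"
    by (intro continuous_intros continuous_on_compose2[OF g]) auto
  show "norm ((1 / h) *\<^sub>R (g (t + h) - g t)) \<le> r / h" for t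
    using r[of t] h by (simp add: divide_right_mono)
qed (rule has_vector_derivative_steklov_average[OF g h])

lemma steklov_average_dist_le:
  fixes g :: "real \<Rightarrow> 'v::banach"
  assumes g: "continuous_on UNIV g" and h: "0 < h"
    and r: "\<And>u. t \<le> u \<Longrightarrow> u \<le> t + h \<Longrightarrow> norm (g u - g t) \<le> r"
  shows "norm (steklov_average h g t - g t) \<le> r"
proof -
  have c: "continuous_on {t..t + h} g" using g by (rule continuous_on_subset) simp
  have "integral {t..t + h} (\<lambda>u. g u - g t) = integral {t..t + h} g - h *\<^sub>R g t"
    using h integrable_continuous_real[OF c] by (subst integral_diff) auto
  then have "steklov_average h g t - g t = (1 / h) *\<^sub>R integral {t..t + h} (\<lambda>u. g u - g t)"
    using h by (simp add: steklov_average_def scaleR_diff_right)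
  moreover have "norm (integral {t..t + h} (\<lambda>u. g u - g t)) \<le> r * (t + h - t)"
    using h r by (intro integral_bound continuous_intros c) auto
  ultimately show ?thesis using h by (simp add: field_simps)
qed

section \<open>Square-summability of the modulus\<close>

text \<open>By monotonicity, twice the integral over \<open>[2\<^sup>-\<^sup>n\<^sup>-\<^sup>1, 2\<^sup>-\<^sup>n]\<close> dominates the term of index \<open>n + 1\<close>.\<close>

lemma summable_dyadic_of_integral:
  fixes m :: "real \<Rightarrow> real"
  assumes nonneg: "\<And>t. t \<in> {0..1} \<Longrightarrow> 0 \<le> m t" and mono: "mono_on {0..1} m"
    and int: "(\<integral>\<^sup>+ t\<in>{0..1}. ennreal ((m t)\<^sup>2 / t) \<partial>lborel) < \<infinity>"
  shows "summable (\<lambda>n. (m ((1 / 2) ^ n))\<^sup>2)"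
proof -
  define q :: "nat \<Rightarrow> real" where "q n = (1 / 2) ^ n" for n
  define b where "b n = (m (q (Suc n)))\<^sup>2" for n
  \<comment> \<open>Half-open intervals are pairwise disjoint, so at most one indicator is nonzero
    at any point.\<close>
  define J where "J n = {q (Suc n)<..q n}" for n
  define I where "I = (\<integral>\<^sup>+ t\<in>{0..1}. ennreal ((m t)\<^sup>2 / t) \<partial>lborel)"
  have q: "0 < q n" "q n \<le> 1" "q (Suc n) = q n / 2" for n
    by (auto simp: q_def power_le_one)
  have q_mono: "q k \<le> q n" if "n \<le> k" for n k
    unfolding q_def using that by (intro power_decreasing) auto
  have disj: "disjoint_family J"
    unfolding disjoint_family_on_def
  proof (intro ballI impI)
    have "J i \<inter> J k = {}" if "i < k" for i k
      using q_mono[of "Suc i" k] that unfolding J_def by fastforce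
    then show "J i \<inter> J k = {}" if "i \<noteq> k" for i k
      using that by (metis Int_commute linorder_neqE_nat)
  qed
  \<comment> \<open>The step function with value \<open>b n / q n\<close> on \<open>J n\<close> lies
    below the integrand, and \<open>J n\<close> has length \<open>q n / 2\<close>.\<close>
  have "ennreal (\<Sum>n<k. b n / 2) \<le> I" for k
  proof -
    have "ennreal (\<Sum>n<k. b n / 2) = (\<Sum>n<k. ennreal (b n / q n) * emeasure lborel (J n))"
    proof (subst sum_ennreal[symmetric])
      show "(\<Sum>n<k. ennreal (b n / 2)) = (\<Sum>n<k. ennreal (b n / q n) * emeasure lborel (J n))"
      proof (rule sum.cong)
        fix n
        have "emeasure lborel (J n) = ennreal (q n / 2)"
          using q(1)[of n] by (simp add: J_def q(3))
        then show "ennreal (b n / 2) = ennreal (b n / q n) * emeasure lborel (J n)"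
          using q(1)[of n] by (simp add: b_def flip: ennreal_mult)
      qed simp
    qed (simp add: b_def)
    also have "\<dots> = (\<integral>\<^sup>+ t. (\<Sum>n<k. ennreal (b n / q n) * indicator (J n) t) \<partial>lborel)"
      by (subst nn_integral_sum) (auto simp: nn_integral_cmult_indicator J_def)
    also have "\<dots> \<le> I"
      unfolding I_def
    proof (rule nn_integral_mono)
      fix t :: real
      show "(\<Sum>n<k. ennreal (b n / q n) * indicator (J n) t) \<le> ennreal ((m t)\<^sup>2 / t) * indicator {0..1} t"
      proof (cases "\<exists>n<k. t \<in> J n")
        case True
        then obtain n where n: "n < k" "t \<in> J n" by blast
        then have "indicator (J i) t = (if i = n then 1 else 0 :: ennreal)" for i
          using disj by (auto simp: disjoint_family_on_def indicator_def)
        then have "(\<Sum>i<k. ennreal (b i / q i) * indicator (J i) t)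
            = (\<Sum>i<k. if i = n then ennreal (b n / q n) else 0)"
          by (intro sum.cong) auto
        also have "\<dots> = ennreal (b n / q n)" using n(1) by simp
        finally have "(\<Sum>i<k. ennreal (b i / q i) * indicator (J i) t) = ennreal (b n / q n)" .
        moreover have t: "q (Suc n) < t" "t \<le> q n" using n(2) by (auto simp: J_def)
        have t1: "t \<in> {0..1}" "0 < t" using t q(1)[of "Suc n"] q(2)[of n] by auto
        have "m (q (Suc n)) \<le> m t"
          using t t1 q(1,2)[of "Suc n"] by (intro mono_onD[OF mono]) auto
        then have "b n \<le> (m t)\<^sup>2"
          unfolding b_def using nonneg[of "q (Suc n)"] q(1,2)[of "Suc n"] by (intro power_mono) auto
        then have "b n / q n \<le> (m t)\<^sup>2 / t"
          using t t1 by (intro frac_le) auto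
        ultimately show ?thesis using t1 by (simp add: ennreal_leI)
      next
        case False
        then have "(\<Sum>n<k. ennreal (b n / q n) * indicator (J n) t) = 0"
          by (intro sum.neutral) (auto simp: indicator_def)
        then show ?thesis by simp
      qed
    qed
    finally show ?thesis .
  qed
  then have "(\<Sum>n<k. b n) \<le> 2 * enn2real I" for k
  proof -
    have "ennreal (\<Sum>n<k. b n / 2) \<le> ennreal (enn2real I)"
      using \<open>ennreal (\<Sum>n<k. b n / 2) \<le> I\<close> int by (simp add: I_def)
    then have "(\<Sum>n<k. b n / 2) \<le> enn2real I" by (simp add: ennreal_le_iff)
    then show ?thesis by (simp flip: sum_divide_distrib)
  qed
  then have "summable b"
    by (intro summableI_nonneg_bounded[of _ "2 * enn2real I"]) (auto simp: b_def)
  \<comment> \<open>\<open>b\<close> starts with the term of index 1; one more term does not affect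
    summability.\<close>
  then show ?thesis
    by (subst summable_Suc_iff[symmetric]) (simp add: b_def[abs_def] q_def)
qed

section \<open>Existence of the rough path\<close>

text \<open>The increments form an absolutely convergent series. Expanding it from an arbitrary
  index \<open>n\<close> yields the error as a tail, a rate that the convergence of areas in
  1-variation relies on.\<close>

lemma convergent_of_summable_increments:
  fixes X :: "nat \<Rightarrow> 'w::banach"
  assumes X: "\<And>n. norm (X (Suc n) - X n) \<le> a n" and a: "summable a"
  shows "X \<longlonglongrightarrow> lim X" "norm (lim X - X n) \<le> suminf (\<lambda>k. a (k + n))"
proof -
  have sm: "summable (\<lambda>k. X (Suc (k + n)) - X (k + n))" for n
    by (rule summable_comparison_test[of _ "\<lambda>k. a (k + n)"])
       (use X a summable_iff_shift[of a n] in auto)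
  have L: "X \<longlonglongrightarrow> suminf (\<lambda>k. X (Suc (k + n)) - X (k + n)) + X n" for n
  proof -
    have "(\<Sum>i<k. X (Suc (i + n)) - X (i + n)) = X (k + n) - X n" for k
      using sum_lessThan_telescope[of "\<lambda>i. X (i + n)" k] by simp
    with summable_LIMSEQ[OF sm[of n]]
    have "(\<lambda>k. X (k + n) - X n) \<longlonglongrightarrow> suminf (\<lambda>k. X (Suc (k + n)) - X (k + n))" by simp
    from tendsto_add[OF this tendsto_const[of "X n"]] show ?thesis
      by (simp add: LIMSEQ_offset)
  qed
  then show "X \<longlonglongrightarrow> lim X" by (metis limI)
  have "lim X - X n = suminf (\<lambda>k. X (Suc (k + n)) - X (k + n))"
    using limI[OF L[of n]] by simp
  then show "norm (lim X - X n) \<le> suminf (\<lambda>k. a (k + n))"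
    using X a summable_iff_shift[of a n] by (simp add: norm_suminf_le)
qed

text \<open>Each of the two elementary tensors in the bracket has norm at most
  \<open>norm v * norm u\<close>, whence the constant 2.\<close>

lemma bounded_bilinear_bracket:
  fixes \<iota> :: "'v::real_normed_vector tensor2 \<Rightarrow> 'w::banach"
  assumes N: "tensor_norm N" and \<iota>: "tensor_completion N \<iota>"
  shows "bounded_bilinear (bracket \<iota>)" "norm (bracket \<iota> v u) \<le> 2 * norm v * norm u"
proof -
  have lin: "linear \<iota>" and norm_\<iota>: "\<And>x. norm (\<iota> x) = N x"
    using \<iota> by (auto simp: tensor_completion_def)
  have le: "norm (\<iota> (v \<otimes>\<^sub>t u)) \<le> norm v * norm u" for v u :: 'v
    using N by (simp add: norm_\<iota> tensor_norm_def)
  show *: "norm (bracket \<iota> v u) \<le> 2 * norm v * norm u" for v u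
    using norm_triangle_ineq4[of "\<iota> (v \<otimes>\<^sub>t u)" "\<iota> (u \<otimes>\<^sub>t v)"] le[of v u] le[of u v]
    by (simp add: bracket_def linear_diff[OF lin] mult.commute)
  have l: "linear (\<lambda>x. x \<otimes>\<^sub>t y)" "linear (\<lambda>x. y \<otimes>\<^sub>t x)" for y :: 'v
    using bilinear_tensor by (auto simp: bilinear_def)
  show "bounded_bilinear (bracket \<iota>)"
    by (rule bounded_bilinear.intro)
       (use * in \<open>auto simp: bracket_def linear_add[OF l(1)] linear_add[OF l(2)] linear_scale[OF l(1)]
          linear_scale[OF l(2)] linear_diff[OF lin] linear_add[OF lin] linear_scale[OF lin] algebra_simps
          intro!: exI[of _ 2]\<close>)
qed

lemma suminf_tail_tendsto_zero:
  fixes a :: "nat \<Rightarrow> 'a::real_normed_vector"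
  assumes "summable a"
  shows "(\<lambda>n. suminf (\<lambda>k. a (k + n))) \<longlonglongrightarrow> 0"
proof -
  have "(\<lambda>n. suminf a - (\<Sum>i<n. a i)) \<longlonglongrightarrow> suminf a - suminf a"
    by (intro tendsto_intros summable_LIMSEQ assms)
  then show ?thesis by (simp add: suminf_minus_initial_segment[OF assms])
qed

text \<open>For mesh below 2^-n the squared increments are at most
  \<open>(\<mu> n)\<^sup>2 * (t - s)\<close>, and they sum to at most
  \<open>(\<mu> n)\<^sup>2\<close>.\<close>

lemma vanishing_2var_of_modulus:
  fixes \<gamma> :: "real \<Rightarrow> 'v::real_normed_vector"
  assumes inc: "\<And>n s t. 0 \<le> s \<Longrightarrow> s \<le> t \<Longrightarrow> t \<le> 1 \<Longrightarrow> t - s \<le> (1 / 2) ^ n \<Longrightarrow>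
      norm (\<gamma> t - \<gamma> s) \<le> \<mu> n * sqrt (t - s)"
    and \<mu>: "\<mu> \<longlonglongrightarrow> 0"
  shows "vanishing_2var \<gamma>"
  unfolding vanishing_2var_def
proof (rule order_tendstoI)
  fix e :: ennreal assume "0 < e"
  have "(\<lambda>n. ennreal ((\<mu> n)\<^sup>2)) \<longlonglongrightarrow> ennreal (0\<^sup>2)"
    by (intro tendsto_ennrealI tendsto_intros \<mu>)
  with \<open>0 < e\<close> have "\<forall>\<^sub>F n in sequentially. ennreal ((\<mu> n)\<^sup>2) < e"
    by (intro order_tendstoD(2)[of _ "ennreal (0\<^sup>2)"]) auto
  then obtain n where n: "ennreal ((\<mu> n)\<^sup>2) < e"
    using eventually_happens' sequentially_bot by blast
  show "\<forall>\<^sub>F \<delta> in at_right 0. (SUP (n, x) \<in> {(n, x). interval_partition 0 1 n x \<and> mesh_le n x \<delta>}.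
         ennreal (\<Sum>i<n. (norm (\<gamma> (x (Suc i)) - \<gamma> (x i)))\<^sup>2)) < e"
    unfolding eventually_at_right_field
  proof (intro exI[of _ "(1 / 2) ^ n"] conjI allI impI)
    fix \<delta> :: real assume "0 < \<delta>" "\<delta> < (1 / 2) ^ n"
    have "(SUP (n, x) \<in> {(n, x). interval_partition 0 1 n x \<and> mesh_le n x \<delta>}.
         ennreal (\<Sum>i<n. (norm (\<gamma> (x (Suc i)) - \<gamma> (x i)))\<^sup>2)) \<le> ennreal ((\<mu> n)\<^sup>2)"
    proof (rule SUP_least, clarify)
      fix k x assume p: "interval_partition 0 1 k x" "mesh_le k x \<delta>"
      have "(\<Sum>i<k. (norm (\<gamma> (x (Suc i)) - \<gamma> (x i)))\<^sup>2) \<le> (\<mu> n)\<^sup>2 * (1 - 0)"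
      proof (rule interval_partition_sum_le[OF p, of "\<lambda>s t. (norm (\<gamma> t - \<gamma> s))\<^sup>2"])
        fix s t :: real assume st: "0 \<le> s" "s < t" "t \<le> 1" "t - s \<le> \<delta>"
        then have "(norm (\<gamma> t - \<gamma> s))\<^sup>2 \<le> (\<mu> n * sqrt (t - s))\<^sup>2"
          using \<open>\<delta> < (1 / 2) ^ n\<close> by (intro power_mono inc) auto
        then show "(norm (\<gamma> t - \<gamma> s))\<^sup>2 \<le> (\<mu> n)\<^sup>2 * (t - s)"
          using st by (simp add: power_mult_distrib)
      qed
      then show "ennreal (\<Sum>i<k. (norm (\<gamma> (x (Suc i)) - \<gamma> (x i)))\<^sup>2) \<le> ennreal ((\<mu> n)\<^sup>2)"
        by (intro ennreal_leI) simp
    qed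
    with n show "(SUP (n, x) \<in> {(n, x). interval_partition 0 1 n x \<and> mesh_le n x \<delta>}.
         ennreal (\<Sum>i<n. (norm (\<gamma> (x (Suc i)) - \<gamma> (x i)))\<^sup>2)) < e" by simp
  qed simp
qed simp

lemma geometric_2_rough_path_of_modulus:
  fixes \<iota> :: "'v::banach tensor2 \<Rightarrow> 'w::banach" and \<gamma> :: "real \<Rightarrow> 'v"
  assumes B: "bounded_bilinear (bracket \<iota>)"
    and M: "\<And>x y. norm (bracket \<iota> x y) \<le> 2 * norm x * norm y"
    and cont: "continuous_on {0..1} \<gamma>"
    and inc: "\<And>n s t. 0 \<le> s \<Longrightarrow> s \<le> t \<Longrightarrow> t \<le> 1 \<Longrightarrow> t - s \<le> (1 / 2) ^ n \<Longrightarrow>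
      norm (\<gamma> t - \<gamma> s) \<le> \<mu> n * sqrt (t - s)"
    and \<mu>: "\<And>n. 0 \<le> \<mu> n" "decseq \<mu>" "summable (\<lambda>n. (\<mu> n)\<^sup>2)"
  shows "\<exists>\<alpha>. geometric_2_rough_path \<iota> \<gamma> \<alpha>"
proof -
  \<comment> \<open>Constant extension beyond the end points, since the averages look ahead past 1
    and need two-sided derivatives at 0 and 1.\<close>
  define g where "g u = \<gamma> (max 0 (min 1 u))" for u
  have g_eq: "g u = \<gamma> u" if "u \<in> {0..1}" for u using that by (simp add: g_def)
  have g: "continuous_on UNIV g"
    unfolding g_def by (intro continuous_on_compose2[OF cont] continuous_intros) auto
  have g_inc: "norm (g t - g s) \<le> \<mu> n * sqrt (t - s)" if "s \<le> t" "t - s \<le> (1 / 2) ^ n" for s t n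
  proof -
    \<comment> \<open>Clamping to the unit interval is monotone and does not increase distances, so
      the increment bound survives the extension.\<close>
    let ?s = "max 0 (min 1 s)" and ?t = "max 0 (min 1 t)"
    have "norm (g t - g s) \<le> \<mu> n * sqrt (?t - ?s)"
      unfolding g_def using that by (intro inc) auto
    also have "\<dots> \<le> \<mu> n * sqrt (t - s)"
      using that \<mu>(1) by (intro mult_left_mono real_sqrt_le_mono) auto
    finally show ?thesis .
  qed
  define q :: "nat \<Rightarrow> real" where "q n = (1 / 2) ^ n" for n
  \<comment> \<open>\<open>r n\<close> bounds the increments of \<open>g\<close> over lengths up to
    \<open>q n\<close>. It is therefore a uniform error bound for \<open>S n\<close>, and
    \<open>r n / q n\<close> bounds its speed.\<close>
  define r where "r n = \<mu> n * sqrt (q n)" for n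
  define S where "S n = steklov_average (q n) g" for n
  define S' where "S' n t = (1 / q n) *\<^sub>R (g (t + q n) - g t)" for n t
  have q: "0 < q n" "q (Suc n) = q n / 2" for n by (simp_all add: q_def)
  have r: "0 \<le> r n" "(r n)\<^sup>2 = (\<mu> n)\<^sup>2 * q n" for n
    using \<mu>(1) q(1)[of n] by (simp_all add: r_def power_mult_distrib)
  have g_q: "norm (g u - g t) \<le> r n" if "t \<le> u" "u \<le> t + q n" for n t u
  proof -
    have "norm (g u - g t) \<le> \<mu> n * sqrt (u - t)" using that by (intro g_inc) (auto simp: q_def)
    also have "\<dots> \<le> r n" unfolding r_def
      using that \<mu>(1) by (intro mult_left_mono real_sqrt_le_mono) auto
    finally show ?thesis .
  qed
  have C1: "C1_path (S n) (S' n) (r n / q n)" for n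
    unfolding S_def S'_def[abs_def] using q(1)[of n] g_q by (intro C1_path_steklov_average g) auto
  \<comment> \<open>The shorter window also has length at most \<open>q n\<close>, so
    \<open>r n\<close> still bounds the increment; dividing by \<open>q (Suc n) = q n / 2\<close>
    gives the factor 2. Both averages are thus measured at level \<open>n\<close>.\<close>
  have C1_Suc: "C1_path (S (Suc n)) (S' (Suc n)) (2 * r n / q n)" for n
  proof -
    have "norm (g (t + q (Suc n)) - g t) \<le> r n" for t
      using q[of n] by (intro g_q) auto
    then have "C1_path (S (Suc n)) (S' (Suc n)) (r n / q (Suc n))"
      unfolding S_def S'_def[abs_def] using q(1)[of "Suc n"] by (intro C1_path_steklov_average g) auto
    then show ?thesis by (simp add: q(2) mult.commute)
  qed
  have dist: "norm (S n t - g t) \<le> r n" for n t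
    unfolding S_def using q(1)[of n] g_q by (intro steklov_average_dist_le g) auto
  have dist_Suc: "norm (S (Suc n) t - S n t) \<le> 2 * r n" for n t
  proof -
    have "norm (S (Suc n) t - g t) \<le> r n"
      unfolding S_def using q[of n] q(1)[of "Suc n"] g_q[of t _ n] by (intro steklov_average_dist_le g) auto
    then show ?thesis
      using dist[of n t] norm_triangle_ineq4[of "S (Suc n) t - g t" "S n t - g t"] by simp
  qed

  \<comment> \<open>24 = 3 * 2 * 2 * 2: the 3 of \<open>area_C1_diff_le\<close>, the bound 2 of the
    bracket, and a 2 each from the speed \<open>2 * r n / q n\<close> and the distance
    \<open>2 * r n\<close>. The factors \<open>q n\<close> cancel.\<close>
  define a where "a n = 24 * (\<mu> n)\<^sup>2" for n
  define \<rho> where "\<rho> n = suminf (\<lambda>k. a (k + n))" for n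
  have a: "summable a" unfolding a_def by (intro summable_mult \<mu>)
  have a_nonneg: "0 \<le> a n" for n by (simp add: a_def)
  have \<rho>_nonneg: "0 \<le> \<rho> n" for n
    unfolding \<rho>_def using a a_nonneg summable_iff_shift[of a n] by (intro suminf_nonneg) auto
  have \<rho>: "\<rho> \<longlonglongrightarrow> 0" unfolding \<rho>_def by (rule suminf_tail_tendsto_zero[OF a])
  have area_Suc: "norm (area \<iota> (S (Suc n)) s t - area \<iota> (S n) s t) \<le> a n * (t - s)"
    if st: "0 \<le> s" "s \<le> t" "t \<le> 1" for n s t
  proof -
    \<comment> \<open>The speed bound of \<open>S n\<close> is weakened so that both paths share
      one.\<close>
    have "r n / q n \<le> 2 * r n / q n"
      using r(1)[of n] q(1)[of n] by (intro divide_right_mono) auto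
    then have "C1_path (S n) (S' n) (2 * r n / q n)"
      using C1[of n] unfolding C1_path_def by (meson order_trans)
    then have "norm (area \<iota> (S (Suc n)) s t - area \<iota> (S n) s t)
        \<le> 3 * 2 * (2 * r n / q n) * (2 * r n) * (t - s)"
      using st M dist_Suc by (intro area_C1_diff_le[OF B _ _ C1_Suc]) auto
    also have "3 * 2 * (2 * r n / q n) * (2 * r n) = 24 * (r n)\<^sup>2 / q n"
      by (simp add: power2_eq_square)
    also have "\<dots> = a n"
      using q(1)[of n] by (simp add: r(2) a_def)
    finally show ?thesis .
  qed
  define \<alpha> where "\<alpha> s t = lim (\<lambda>n. area \<iota> (S n) s t)" for s t
  \<comment> \<open>The series bound is applied at each fixed pair. Its error is linear in
    \<open>t - s\<close>, as a bound on the 1-variation requires.\<close>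
  have \<alpha>_lim: "(\<lambda>n. area \<iota> (S n) s t) \<longlonglongrightarrow> \<alpha> s t"
    and \<alpha>_le: "norm (\<alpha> s t - area \<iota> (S n) s t) \<le> \<rho> n * (t - s)"
    if st: "0 \<le> s" "s \<le> t" "t \<le> 1" for n s t
  proof -
    have sm: "summable (\<lambda>n. a n * (t - s))" by (intro summable_mult2 a)
    note * = convergent_of_summable_increments[of "\<lambda>n. area \<iota> (S n) s t", OF area_Suc[OF st] sm]
    show "(\<lambda>n. area \<iota> (S n) s t) \<longlonglongrightarrow> \<alpha> s t" unfolding \<alpha>_def by (rule *(1))
    have "suminf (\<lambda>k. a (k + n) * (t - s)) = \<rho> n * (t - s)"
      unfolding \<rho>_def using a summable_iff_shift[of a n] by (intro suminf_mult2[symmetric]) auto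
    then show "norm (\<alpha> s t - area \<iota> (S n) s t) \<le> \<rho> n * (t - s)"
      using *(2)[of n] by (simp add: \<alpha>_def)
  qed
  \<comment> \<open>Lengths are at most 1, so the error is at most \<open>\<rho> n\<close> on the
    whole triangle and continuity passes to the limit.\<close>
  have "uniform_limit triangle (\<lambda>n (s, t). area \<iota> (S n) s t) (\<lambda>(s, t). \<alpha> s t) sequentially"
  proof (rule uniform_limitI)
    fix e :: real assume "e > 0"
    with \<rho> have "\<forall>\<^sub>F n in sequentially. \<rho> n < e" by (rule order_tendstoD)
    then show "\<forall>\<^sub>F n in sequentially. \<forall>x\<in>triangle.
        dist (case x of (s, t) \<Rightarrow> area \<iota> (S n) s t) (case x of (s, t) \<Rightarrow> \<alpha> s t) < e"
    proof eventually_elim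
      case (elim n)
      have "dist (area \<iota> (S n) s t) (\<alpha> s t) < e" if "(s, t) \<in> triangle" for s t
      proof -
        have st: "0 \<le> s" "s \<le> t" "t \<le> 1" using that by (auto simp: triangle_def)
        have "\<rho> n * (t - s) \<le> \<rho> n * 1"
          using st \<rho>_nonneg by (intro mult_left_mono) auto
        with \<alpha>_le[OF st, of n] elim show ?thesis by (simp add: dist_norm norm_minus_commute)
      qed
      then show ?case by auto
    qed
  qed
  then have "continuous_on triangle (\<lambda>(s, t). \<alpha> s t)"
    by (rule uniform_limit_theorem[rotated]) (auto intro!: always_eventually continuous_on_area_C1[OF B C1])
  moreover have "\<alpha> s t \<in> bracket_space \<iota>" if "(s, t) \<in> triangle" for s t
  proof -
    have st: "0 \<le> s" "s \<le> t" "t \<le> 1" using that by (auto simp: triangle_def)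
    show ?thesis
      by (rule Lim_in_closed_set[OF _ _ _ \<alpha>_lim[OF st]])
         (use area_C1_in_bracket_space[OF B C1 st] in \<open>auto simp: bracket_space_def\<close>)
  qed
  \<comment> \<open>On the diagonal the error bound is 0, so \<open>\<alpha> t t\<close> equals the
    area of \<open>S 0\<close> over a degenerate interval.\<close>
  moreover have "\<alpha> t t = 0" if "t \<in> {0..1}" for t
    using \<alpha>_le[of t t 0] that area_C1[OF B C1, of t t 0] by simp
  ultimately have "\<alpha> \<in> C_triangle (bracket_space \<iota>)"
    by (auto simp: C_triangle_def)
  moreover have "(\<lambda>n. ennreal_powr
      ((pvar 2 (increment (\<lambda>t. \<gamma> t - S n t)))\<^sup>2 + pvar 1 (\<lambda>s t. \<alpha> s t - area \<iota> (S n) s t)) (1 / 2)) \<longlonglongrightarrow> 0"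
  proof (rule tendsto_sandwich[OF _ _ tendsto_const])
    \<comment> \<open>In the upper bound, \<open>4 * (\<mu> n)\<^sup>2\<close> comes from the
      increments of \<open>\<gamma> - S n\<close>, at most
      \<open>2 * \<mu> n * sqrt (t - s)\<close>, and \<open>\<rho> n\<close> from the areas.\<close>
    have "(\<lambda>n. (\<mu> n)\<^sup>2) \<longlonglongrightarrow> 0" by (intro summable_LIMSEQ_zero \<mu>)
    then have "(\<lambda>n. 4 * (\<mu> n)\<^sup>2 + \<rho> n) \<longlonglongrightarrow> 4 * 0 + 0" by (intro tendsto_intros \<rho>)
    then have "(\<lambda>n. sqrt (4 * (\<mu> n)\<^sup>2 + \<rho> n)) \<longlonglongrightarrow> sqrt (4 * 0 + 0)" by (rule tendsto_real_sqrt)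
    then show "(\<lambda>n. ennreal (sqrt (4 * (\<mu> n)\<^sup>2 + \<rho> n))) \<longlonglongrightarrow> 0"
      using tendsto_ennrealI by fastforce
    have "ennreal_powr
      ((pvar 2 (increment (\<lambda>t. \<gamma> t - S n t)))\<^sup>2 + pvar 1 (\<lambda>s t. \<alpha> s t - area \<iota> (S n) s t)) (1 / 2)
      \<le> ennreal (sqrt (4 * (\<mu> n)\<^sup>2 + \<rho> n))" for n
    proof -
      have "pvar 1 (\<lambda>s t. \<alpha> s t - area \<iota> (S n) s t) \<le> ennreal (\<rho> n powr (1 / 1))"
        using \<alpha>_le \<rho>_nonneg by (intro pvar_le) auto
      then have p1: "pvar 1 (\<lambda>s t. \<alpha> s t - area \<iota> (S n) s t) \<le> ennreal (\<rho> n)"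
        using \<rho>_nonneg by simp
      have "pvar 2 (increment (\<lambda>t. \<gamma> t - S n t)) \<le> ennreal ((4 * (\<mu> n)\<^sup>2) powr (1 / 2))"
      proof (rule pvar_le)
        fix s t :: real assume st: "0 \<le> s" "s < t" "t \<le> 1"
        have eq: "increment (\<lambda>t. \<gamma> t - S n t) s t = (g t - g s) - (S n t - S n s)"
          using st by (simp add: increment_def g_eq)
        have "(norm (increment (\<lambda>t. \<gamma> t - S n t) s t))\<^sup>2 \<le> 4 * (\<mu> n)\<^sup>2 * (t - s)"
        proof (cases "q n \<le> t - s")
          case True
          have "increment (\<lambda>t. \<gamma> t - S n t) s t = (S n s - g s) - (S n t - g t)"
            by (simp add: eq)
          then have "norm (increment (\<lambda>t. \<gamma> t - S n t) s t) \<le> 2 * r n"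
            using norm_triangle_ineq4[of "S n s - g s" "S n t - g t"] dist[of n s] dist[of n t] by simp
          then have "(norm (increment (\<lambda>t. \<gamma> t - S n t) s t))\<^sup>2 \<le> (2 * r n)\<^sup>2"
            by (intro power_mono) auto
          also have "\<dots> = 4 * (\<mu> n)\<^sup>2 * q n" by (simp add: power_mult_distrib r(2))
          also have "\<dots> \<le> 4 * (\<mu> n)\<^sup>2 * (t - s)" using True by (intro mult_left_mono) auto
          finally show ?thesis .
        next
          case False
          have "norm (g t - g s) \<le> \<mu> n * sqrt (t - s)"
            using False st by (intro g_inc) (auto simp: q_def)
          moreover have "norm (S n t - S n s) \<le> \<mu> n * sqrt (t - s)"
          proof -
            have "norm (S n t - S n s) \<le> r n / q n * (t - s)"
              using st by (intro C1_path.lipschitz[OF C1]) auto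
            \<comment> \<open>Here \<open>r n / q n = \<mu> n / sqrt (q n)\<close>; one of the two
              factors \<open>sqrt (t - s)\<close> is then traded for the larger
              \<open>sqrt (q n)\<close>.\<close>
            also have "\<dots> = \<mu> n * (sqrt (t - s) * sqrt (t - s) / sqrt (q n))"
              using q(1)[of n] st by (simp add: r_def field_simps)
            also have "\<dots> \<le> \<mu> n * (sqrt (t - s) * sqrt (q n) / sqrt (q n))"
              using q(1)[of n] st False \<mu>(1)
              by (intro mult_left_mono divide_right_mono real_sqrt_le_mono) auto
            also have "\<dots> = \<mu> n * sqrt (t - s)" using q(1)[of n] by simp
            finally show ?thesis .
          qed
          ultimately have "norm (increment (\<lambda>t. \<gamma> t - S n t) s t) \<le> 2 * \<mu> n * sqrt (t - s)"
            unfolding eq using norm_triangle_ineq4[of "g t - g s" "S n t - S n s"] by simp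
          then have "(norm (increment (\<lambda>t. \<gamma> t - S n t) s t))\<^sup>2 \<le> (2 * \<mu> n * sqrt (t - s))\<^sup>2"
            by (intro power_mono) auto
          then show ?thesis using st by (simp add: power_mult_distrib)
        qed
        then show "norm (increment (\<lambda>t. \<gamma> t - S n t) s t) powr 2 \<le> 4 * (\<mu> n)\<^sup>2 * (t - s)" by simp
      qed auto
      then have "(pvar 2 (increment (\<lambda>t. \<gamma> t - S n t)))\<^sup>2 \<le> (ennreal ((4 * (\<mu> n)\<^sup>2) powr (1 / 2)))\<^sup>2"
        by (intro power_mono) auto
      also have "\<dots> = ennreal (4 * (\<mu> n)\<^sup>2)"
        by (simp add: ennreal_power powr_half_sqrt del: real_sqrt_mult)
      finally have "(pvar 2 (increment (\<lambda>t. \<gamma> t - S n t)))\<^sup>2 + pvar 1 (\<lambda>s t. \<alpha> s t - area \<iota> (S n) s t)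
          \<le> ennreal (4 * (\<mu> n)\<^sup>2 + \<rho> n)"
        using p1 \<rho>_nonneg[of n] by (simp add: add_mono ennreal_plus)
      from ennreal_powr_mono[OF this, of "1 / 2"] show ?thesis
        using \<rho>_nonneg[of n]
        by (simp add: ennreal_powr_ennreal powr_half_sqrt del: ennreal_plus)
    qed
    then show "\<forall>\<^sub>F n in sequentially. ennreal_powr
      ((pvar 2 (increment (\<lambda>t. \<gamma> t - S n t)))\<^sup>2 + pvar 1 (\<lambda>s t. \<alpha> s t - area \<iota> (S n) s t)) (1 / 2)
      \<le> ennreal (sqrt (4 * (\<mu> n)\<^sup>2 + \<rho> n))" by simp
  qed simp
  ultimately have "geometric_2_rough_path \<iota> \<gamma> \<alpha>"
    unfolding geometric_2_rough_path_def using cont C1_path.in_C_1var[OF C1] by blast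
  then show ?thesis by blast
qed

theorem theorem33:
  fixes N :: "'v::banach tensor2 \<Rightarrow> real"
    and \<iota> :: "'v tensor2 \<Rightarrow> 'w::banach"
    and \<gamma> :: "real \<Rightarrow> 'v"
  assumes "tensor_norm N" and "tensor_completion N \<iota>"
    and "continuous_on {0..1} \<gamma>"
    and "\<exists>m :: real \<Rightarrow> real.
           (\<forall>t\<in>{0..1}. 0 \<le> m t) \<and> mono_on {0..1} m
         \<and> (m \<longlongrightarrow> 0) (at 0 within {0..1}) \<and> m 1 \<le> 1
         \<and> (\<integral>\<^sup>+ t\<in>{0..1}. ennreal ((m t)\<^sup>2 / t) \<partial>lborel) < \<infinity>
         \<and> (SUP (s, t) \<in> {(s, t). 0 \<le> s \<and> s < t \<and> t \<le> 1}.
              ennreal (norm (\<gamma> t - \<gamma> s)) / ennreal (\<bar>t - s\<bar> powr (1 / 2) * m (t - s))) < \<infinity>"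
  shows "\<gamma> \<in> G2 \<iota>"
proof -
  obtain m :: "real \<Rightarrow> real" where m: "\<And>t. t \<in> {0..1} \<Longrightarrow> 0 \<le> m t" "mono_on {0..1} m"
    and int: "(\<integral>\<^sup>+ t\<in>{0..1}. ennreal ((m t)\<^sup>2 / t) \<partial>lborel) < \<infinity>"
    and sup: "(SUP (s, t) \<in> {(s, t). 0 \<le> s \<and> s < t \<and> t \<le> 1}.
      ennreal (norm (\<gamma> t - \<gamma> s)) / ennreal (\<bar>t - s\<bar> powr (1 / 2) * m (t - s))) < \<infinity>" (is "?C < _")
    using assms(4) by blast
  define c where "c = enn2real ?C"
  have c: "0 \<le> c" "?C = ennreal c" using sup by (simp_all add: c_def)
  have holder: "norm (\<gamma> t - \<gamma> s) \<le> c * (sqrt (t - s) * m (t - s))" if st: "0 \<le> s" "s < t" "t \<le> 1" for s t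
  proof -
    let ?y = "sqrt (t - s) * m (t - s)"
    have "ennreal (norm (\<gamma> t - \<gamma> s)) / ennreal (\<bar>t - s\<bar> powr (1 / 2) * m (t - s)) \<le> ?C"
      using st by (intro SUP_upper2[of "(s, t)"]) auto
    then have le: "ennreal (norm (\<gamma> t - \<gamma> s)) / ennreal ?y \<le> ennreal c"
      using st c(2) by (simp add: powr_half_sqrt)
    have "0 \<le> ?y" using st m(1)[of "t - s"] by auto
    show ?thesis
    proof (cases "?y = 0")
      \<comment> \<open>The denominator is 0 if \<open>m\<close> vanishes at \<open>t - s\<close>. A
        nonzero increment would then make the quotient infinite, against the finite
        supremum.\<close>
      case True
      with le have "norm (\<gamma> t - \<gamma> s) = 0"
        by (cases "norm (\<gamma> t - \<gamma> s) = 0") (auto simp: ennreal_divide_zero top_unique)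
      then show ?thesis unfolding True by simp
    next
      case False
      with \<open>0 \<le> ?y\<close> have "0 < ?y" by linarith
      with le c(1) have "norm (\<gamma> t - \<gamma> s) / ?y \<le> c" by (simp add: divide_ennreal del: mult_pos_pos)
      with \<open>0 < ?y\<close> show ?thesis by (simp only: pos_divide_le_eq)
    qed
  qed
  \<comment> \<open>By monotonicity \<open>m (t - s)\<close> is at most the value of
    \<open>m\<close> at any dyadic scale not below \<open>t - s\<close>, so the dyadic values
    suffice as a modulus.\<close>
  define \<mu> where "\<mu> n = c * m ((1 / 2) ^ n)" for n
  have q: "(1 / 2) ^ n \<in> {0..1::real}" for n by (simp add: power_le_one)
  have inc: "norm (\<gamma> t - \<gamma> s) \<le> \<mu> n * sqrt (t - s)"
    if "0 \<le> s" "s \<le> t" "t \<le> 1" "t - s \<le> (1 / 2) ^ n" for n s t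
  proof (cases "s = t")
    case False
    with that have "norm (\<gamma> t - \<gamma> s) \<le> c * (sqrt (t - s) * m (t - s))" by (intro holder) auto
    also have "\<dots> \<le> c * (sqrt (t - s) * m ((1 / 2) ^ n))"
      using that q[of n] c(1) by (intro mult_left_mono mono_onD[OF m(2)]) auto
    finally show ?thesis by (simp add: \<mu>_def mult_ac)
  qed simp
  have \<mu>: "0 \<le> \<mu> n" for n using m(1) q c(1) by (simp add: \<mu>_def)
  have dec: "decseq \<mu>"
  proof (rule decseq_SucI)
    show "\<mu> (Suc n) \<le> \<mu> n" for n
      unfolding \<mu>_def using c(1) q[of n] q[of "Suc n"]
      by (intro mult_left_mono mono_onD[OF m(2)]) auto
  qed
  have sm: "summable (\<lambda>n. (\<mu> n)\<^sup>2)"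
    using summable_dyadic_of_integral[OF m int] by (simp add: \<mu>_def power_mult_distrib summable_mult)
  then have "(\<lambda>n. sqrt ((\<mu> n)\<^sup>2)) \<longlonglongrightarrow> sqrt 0"
    by (intro tendsto_real_sqrt summable_LIMSEQ_zero)
  with \<mu> have "\<mu> \<longlonglongrightarrow> 0" by simp
  then have "vanishing_2var \<gamma>" using inc by (intro vanishing_2var_of_modulus) auto
  moreover have "\<exists>\<alpha>. geometric_2_rough_path \<iota> \<gamma> \<alpha>"
    using inc \<mu> dec sm
    by (intro geometric_2_rough_path_of_modulus assms(3) bounded_bilinear_bracket[OF assms(1,2)]) auto
  ultimately show ?thesis by (simp add: G2_def)
qed

end
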